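(* There is a polynomial-time (randomized) algorithm that, given a set $P\subseteq\mathcal S_n$ of $m$ permutations of $[n]$ and element weights $w$, provides with high probability a $1.968$-approximate solution to the $1$-median problem for $P$ under the element-weighted Ulam metric.
   Context: $\mathcal S_n$ is the set of permutations of $[n]$ viewed as strings, and $w:[n]\to\mathbb R_{>0}$ is a weight function. The element-weighted Ulam distance $\mathrm{dist}^w_U(p,q)$ is the minimum total weight of elements that must be moved (removed and reinserted elsewhere) to transform $p$ into $q$; equivalently $\mathrm{dist}^w_U(p,q)=\sum_{e\in[n]}w(e)-\max_{C}\sum_{e\in C}w(e)$, the maximum over common subsequences $C$ of $p$ and $q$. 1-median problem: for $P=\{p_1,\dots,p_m\}\subseteq\mathcal S_n$, let $\mathrm{cost}(x,P)=\frac1m\sum_{i=1}^m\mathrm{dist}^w_U(x,p_i)$ and $\mathrm{OPT}=\min_{x\in\mathcal S_n}\mathrm{cost}(x,P)$. A $\beta$-approximate solution is $y\in\mathcal S_n$ with $\mathrm{cost}(y,P)\le\beta\,\mathrm{OPT}$. "With high probability" means probability at least $1-1/\mathrm{poly}(n)$. *)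

theory Defs
  imports
    "HOL-Probability.Probability"
    "HOL-Combinatorics.Multiset_Permutations"
    "HOL-Library.Sublist"
    "HOL-Computational_Algebra.Polynomial"
begin

section \<open>The element-weighted Ulam metric and the 1-median problem\<close>

text \<open>Permutations of \<open>[n]\<close> are strings, i.e. lists containing each of \<open>1, \<dots>, n\<close> exactly once.\<close>

abbreviation perms :: "nat \<Rightarrow> nat list set" where
  "perms n \<equiv> permutations_of_set {1..n}"

definition move :: "'a \<Rightarrow> 'a list \<Rightarrow> 'a list \<Rightarrow> bool" where
  "move e p q \<longleftrightarrow> (\<exists>us vs us' vs'. p = us @ e # vs \<and> q = us' @ e # vs' \<and> us @ vs = us' @ vs')"

text \<open>\<open>moves p es q\<close>: moving the elements \<open>es\<close>, one after the other, transforms \<open>p\<close> into \<open>q\<close>.\<close>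

inductive moves :: "'a list \<Rightarrow> 'a list \<Rightarrow> 'a list \<Rightarrow> bool" where
  Nil: "moves p [] p"
| Cons: "move e p q \<Longrightarrow> moves q es r \<Longrightarrow> moves p (e # es) r"

definition ulam_dist :: "('a \<Rightarrow> real) \<Rightarrow> 'a list \<Rightarrow> 'a list \<Rightarrow> real" where
  "ulam_dist w p q = (INF es\<in>{es. moves p es q}. \<Sum>e\<leftarrow>es. w e)"

definition cost :: "('a \<Rightarrow> real) \<Rightarrow> 'a list \<Rightarrow> 'a list set \<Rightarrow> real" where
  "cost w x P = (\<Sum>p\<in>P. ulam_dist w x p) / real (card P)"

definition OPT :: "nat \<Rightarrow> (nat \<Rightarrow> real) \<Rightarrow> nat list set \<Rightarrow> real" where
  "OPT n w P = Min ((\<lambda>x. cost w x P) ` perms n)"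

definition approx_medians :: "real \<Rightarrow> nat \<Rightarrow> (nat \<Rightarrow> real) \<Rightarrow> nat list set \<Rightarrow> nat list set" where
  "approx_medians \<beta> n w P = {y \<in> perms n. cost w y P \<le> \<beta> * OPT n w P}"


subsection \<open>The distance in terms of common subsequences\<close>

lemma move_filter:
  assumes "move e p q" "e \<in> X"
  shows "filter (\<lambda>x. x \<notin> X) p = filter (\<lambda>x. x \<notin> X) q"
proof -
  from assms obtain us vs us' vs' where
    pq: "p = us @ e # vs" "q = us' @ e # vs'" "us @ vs = us' @ vs'"
    unfolding move_def by blast
  from pq(3) have "filter (\<lambda>x. x \<notin> X) (us @ vs) = filter (\<lambda>x. x \<notin> X) (us' @ vs')"
    by (rule arg_cong)
  with assms(2) show ?thesis unfolding pq(1,2) by simp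
qed

lemma move_set:
  assumes "move e p q"
  shows "e \<in> set p" "set q = set p"
proof -
  from assms obtain us vs us' vs' where
    pq: "p = us @ e # vs" "q = us' @ e # vs'" "us @ vs = us' @ vs'"
    unfolding move_def by blast
  from pq(3) have "set (us @ vs) = set (us' @ vs')" by (rule arg_cong)
  then show "e \<in> set p" "set q = set p" unfolding pq(1,2) by auto
qed

lemma moves_filter:
  "moves p es q \<Longrightarrow> set es \<subseteq> X \<Longrightarrow> filter (\<lambda>x. x \<notin> X) p = filter (\<lambda>x. x \<notin> X) q"
proof (induction rule: moves.induct)
  case (Cons e p q es r)
  then show ?case using move_filter[of e p q X] by simp
qed simp

lemma filter_eq_append_split:
  "filter Q r = A @ B \<Longrightarrow> \<exists>U V. r = U @ V \<and> filter Q U = A \<and> filter Q V = B"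
proof (induction r arbitrary: A)
  case Nil
  then show ?case by simp
next
  case (Cons x r)
  show ?case
  proof (cases "Q x \<and> A \<noteq> []")
    case True
    then obtain A' where A: "A = x # A'" and "filter Q r = A' @ B"
      using Cons.prems by (cases A) auto
    then obtain U V where "r = U @ V" "filter Q U = A'" "filter Q V = B"
      using Cons.IH by blast
    then have "x # r = (x # U) @ V \<and> filter Q (x # U) = A \<and> filter Q V = B"
      using True A by simp
    then show ?thesis by blast
  next
    case False
    show ?thesis
    proof (cases "Q x")
      case True
      with False Cons.prems have "x # r = [] @ (x # r) \<and> filter Q [] = A \<and> filter Q (x # r) = B"
        by simp
      then show ?thesis by blast
    next
      case nQ: False
      with Cons.prems have "filter Q r = A @ B" by simp
      then obtain U V where "r = U @ V" "filter Q U = A" "filter Q V = B"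
        using Cons.IH by blast
      then have "x # r = (x # U) @ V \<and> filter Q (x # U) = A \<and> filter Q V = B"
        using nQ by simp
      then show ?thesis by blast
    qed
  qed
qed

lemma moves_exist:
  assumes "distinct p" "distinct q" "set p = set q" "distinct es" "set es \<subseteq> set p"
    and "filter (\<lambda>x. x \<notin> set es) p = filter (\<lambda>x. x \<notin> set es) q"
  shows "moves p es q"
  using assms
proof (induction es arbitrary: p)
  case Nil
  then show ?case by (simp add: moves.Nil)
next
  case (Cons e es)
  let ?Q = "\<lambda>x. x \<notin> set es"
  from Cons.prems have e: "e \<in> set p" "e \<in> set q" "e \<notin> set es" by auto
  from e(1) obtain us vs where p: "p = us @ e # vs" by (meson split_list)
  from e(2) obtain us' vs' where q: "q = us' @ e # vs'" by (meson split_list)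
  have np: "e \<notin> set us" "e \<notin> set vs" using p Cons.prems(1) by auto
  have nq: "e \<notin> set us'" "e \<notin> set vs'" using q Cons.prems(2) by auto
  have c: "filter (\<lambda>x. x \<notin> set (e # es)) l = filter ?Q l" if "e \<notin> set l" for l
    using that by (intro filter_cong) auto
  have "filter ?Q (us @ vs) = filter ?Q us' @ filter ?Q vs'"
    using Cons.prems(6) c[OF np(1)] c[OF np(2)] c[OF nq(1)] c[OF nq(2)] unfolding p q by simp
  then obtain U V where UV: "us @ vs = U @ V" "filter ?Q U = filter ?Q us'"
      "filter ?Q V = filter ?Q vs'"
    using filter_eq_append_split by blast
  let ?p = "U @ e # V"
  have "move e p ?p" unfolding move_def using p UV(1) by blast
  have "mset us + mset vs = mset U + mset V"
    using UV(1) by (metis mset_append)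
  then have "mset ?p = mset p" unfolding p by simp
  then have "distinct ?p" "set ?p = set p"
    using Cons.prems(1) mset_eq_imp_distinct_iff mset_eq_setD by metis+
  moreover have "filter ?Q ?p = filter ?Q q"
    unfolding q using UV e by simp
  ultimately have "moves ?p es q"
    using Cons.prems by (intro Cons.IH) auto
  with \<open>move e p ?p\<close> show ?case by (rule moves.Cons)
qed

lemma subseq_set: "subseq C p \<Longrightarrow> set C \<subseteq> set p"
  by (induction rule: list_emb.induct) auto

lemma subseq_distinct_filter:
  "subseq C p \<Longrightarrow> distinct p \<Longrightarrow> filter (\<lambda>x. x \<in> set C) p = C"
proof (induction rule: list_emb.induct)
  case (list_emb_Nil ys)
  then show ?case by simp
next
  case (list_emb_Cons xs ys y)
  have "y \<notin> set xs" using list_emb_Cons.hyps list_emb_Cons.prems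
    using subseq_set by fastforce
  then show ?case using list_emb_Cons by simp
next
  case (list_emb_Cons2 x y xs ys)
  have "filter (\<lambda>z. z \<in> set (x # xs)) ys = filter (\<lambda>z. z \<in> set xs) ys"
    using list_emb_Cons2 by (intro filter_cong) auto
  then show ?case using list_emb_Cons2 by simp
qed

theorem ulam_dist_common_subseq:
  assumes p: "p \<in> perms n" and q: "q \<in> perms n" and w: "\<And>e. e \<in> {1..n} \<Longrightarrow> w e > 0"
  shows "ulam_dist w p q =
    (\<Sum>e=1..n. w e) - Max {\<Sum>e\<in>set C. w e |C. subseq C p \<and> subseq C q}"
proof -
  have sp: "set p = {1..n}" "distinct p" and sq: "set q = {1..n}" "distinct q"
    using p q by (auto dest: permutations_of_setD)
  let ?M = "{\<Sum>e\<in>set C. w e |C. subseq C p \<and> subseq C q}"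
  have "?M \<subseteq> (\<lambda>C. \<Sum>e\<in>set C. w e) ` {C. subseq C p}" by auto
  moreover have "finite {C. subseq C p}"
    unfolding set_subseqs_eq[symmetric] by (rule List.finite_set)
  ultimately have fin: "finite ?M" using finite_surj by blast
  have "subseq [] p \<and> subseq [] q" by simp
  then have ne: "?M \<noteq> {}" by blast
  from Max_in[OF fin ne] obtain C where C: "subseq C p" "subseq C q"
    and CM: "Max ?M = (\<Sum>e\<in>set C. w e)" by auto
  have wpos: "w e \<ge> 0" if "e \<in> {1..n}" for e using w[OF that] by simp
  define es where "es = filter (\<lambda>x. x \<notin> set C) p"
  have Cp: "set C \<subseteq> {1..n}" unfolding sp(1)[symmetric] by (rule subseq_set[OF C(1)])
  have ses: "set es = {1..n} - set C" "distinct es" unfolding es_def set_filter sp(1)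
    using sp(2) by (simp_all add: set_diff_eq)
  have f: "filter (\<lambda>x. x \<notin> set es) l = filter (\<lambda>x. x \<in> set C) l" if "set l = {1..n}" for l
    using that ses by (intro filter_cong) auto
  have mv: "moves p es q"
    using sp sq ses f[OF sp(1)] f[OF sq(1)] subseq_distinct_filter[OF C(1) sp(2)]
      subseq_distinct_filter[OF C(2) sq(2)]
    by (intro moves_exist) auto
  have val: "(\<Sum>e\<leftarrow>es. w e) = (\<Sum>e=1..n. w e) - Max ?M"
    using ses Cp unfolding CM by (simp add: sum_list_distinct_conv_sum_set sum_diff)
  have low: "(\<Sum>e=1..n. w e) - Max ?M \<le> (\<Sum>e\<leftarrow>fs. w e)" if "moves p fs q" for fs
  proof -
    define D where "D = filter (\<lambda>x. x \<notin> set fs) p"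
    have Dq: "D = filter (\<lambda>x. x \<notin> set fs) q"
      unfolding D_def using that by (intro moves_filter) auto
    have "subseq D p" unfolding D_def by simp
    moreover have "subseq D q" unfolding Dq by simp
    ultimately have "(\<Sum>e\<in>set D. w e) \<in> ?M" by blast
    then have "(\<Sum>e\<in>set D. w e) \<le> Max ?M" by (rule Max_ge[OF fin])
    have "set fs \<subseteq> set p"
      using that
    proof (induction rule: moves.induct)
      case (Cons e p q es r)
      then show ?case using move_set[OF Cons.hyps(1)] by simp
    qed simp
    have "(\<Sum>e\<in>set fs. w e) \<le> (\<Sum>e\<leftarrow>fs. w e)"
      using \<open>set fs \<subseteq> set p\<close>
    proof (induction fs)
      case (Cons a fs)
      have "a \<in> {1..n}" using Cons.prems sp by auto
      then show ?case using Cons wpos[of a] by (cases "a \<in> set fs") (auto simp: insert_absorb)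
    qed simp
    moreover have "(\<Sum>e=1..n. w e) = (\<Sum>e\<in>set D. w e) + (\<Sum>e\<in>set fs. w e)"
    proof -
      have "{1..n} = set D \<union> set fs" "set D \<inter> set fs = {}"
        unfolding D_def using sp \<open>set fs \<subseteq> set p\<close> by auto
      then show ?thesis using sum.union_disjoint[of "set D" "set fs" w] by simp
    qed
    ultimately show ?thesis using \<open>_ \<le> Max ?M\<close> by linarith
  qed
  show ?thesis
    unfolding ulam_dist_def
  proof (rule cInf_eq_minimum)
    show "(\<Sum>e=1..n. w e) - Max ?M \<in> (\<lambda>es. \<Sum>e\<leftarrow>es. w e) ` {es. moves p es q}"
      using mv val by (intro image_eqI[of _ _ es]) auto
  qed (use low in auto)
qed


section \<open>Randomized real-RAM programs\<close>

text \<open>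
  The weights are arbitrary positive reals, so the model of computation is the real RAM, with unit
  cost per executed instruction. The memory consists of named, unbounded arrays, with separate
  arrays for natural numbers and for reals; a scalar variable is an array used at index 0. Two
  restrictions keep unit cost honest: there is no multiplication on the naturals (repeated squaring
  would produce numbers of exponential length in polynomially many steps), and reals cannot be
  converted into naturals. Real constants are rational. The only source of randomness is a
  fair coin.
\<close>

datatype nexp =
    NConst nat
  | NAt string nexp
  | NPlus nexp nexp
  | NMinus nexp nexp  (* truncated at 0 *)

datatype rexp =
    RConst rat
  | RAt string nexp
  | RPlus rexp rexp
  | RMinus rexp rexp
  | RTimes rexp rexp
  | RDivide rexp rexp  (* x / 0 = 0 *)

datatype bexp =
    NLess nexp nexp
  | RLess rexp rexp
  | Not bexp
  | And bexp bexp

datatype com =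
    SKIP
  | NAssign string nexp nexp  (* array, index, value *)
  | RAssign string nexp rexp
  | Flip string nexp  (* array, index *)
  | Seq com com
  | If bexp com com
  | While bexp com

record state =
  nats :: "string \<Rightarrow> nat \<Rightarrow> nat"
  reals :: "string \<Rightarrow> nat \<Rightarrow> real"

primrec nval :: "nexp \<Rightarrow> state \<Rightarrow> nat" where
  "nval (NConst k) s = k"
| "nval (NAt a i) s = nats s a (nval i s)"
| "nval (NPlus e f) s = nval e s + nval f s"
| "nval (NMinus e f) s = nval e s - nval f s"

primrec rval :: "rexp \<Rightarrow> state \<Rightarrow> real" where
  "rval (RConst r) s = of_rat r"
| "rval (RAt a i) s = reals s a (nval i s)"
| "rval (RPlus e f) s = rval e s + rval f s"
| "rval (RMinus e f) s = rval e s - rval f s"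
| "rval (RTimes e f) s = rval e s * rval f s"
| "rval (RDivide e f) s = rval e s / rval f s"

primrec bval :: "bexp \<Rightarrow> state \<Rightarrow> bool" where
  "bval (NLess e f) s \<longleftrightarrow> nval e s < nval f s"
| "bval (RLess e f) s \<longleftrightarrow> rval e s < rval f s"
| "bval (Not b) s \<longleftrightarrow> \<not> bval b s"
| "bval (And b c) s \<longleftrightarrow> bval b s \<and> bval c s"

definition nset :: "string \<Rightarrow> nat \<Rightarrow> nat \<Rightarrow> state \<Rightarrow> state" where
  "nset a i v s = s\<lparr>nats := (nats s)(a := (nats s a)(i := v))\<rparr>"

definition rset :: "string \<Rightarrow> nat \<Rightarrow> real \<Rightarrow> state \<Rightarrow> state" where
  "rset a i v s = s\<lparr>reals := (reals s)(a := (reals s a)(i := v))\<rparr>"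

text \<open>
  One execution step. A step evaluates only expressions that occur in the program text, whose size
  does not depend on the input.
\<close>

fun step :: "com \<times> state \<Rightarrow> (com \<times> state) pmf" where
  "step (SKIP, s) = return_pmf (SKIP, s)"
| "step (NAssign a i e, s) = return_pmf (SKIP, nset a (nval i s) (nval e s) s)"
| "step (RAssign a i e, s) = return_pmf (SKIP, rset a (nval i s) (rval e s) s)"
| "step (Flip a i, s) =
     map_pmf (\<lambda>b. (SKIP, nset a (nval i s) (of_bool b) s)) (bernoulli_pmf (1 / 2))"
| "step (Seq c d, s) =
     (if c = SKIP then return_pmf (d, s)
      else map_pmf (\<lambda>(c', s'). (Seq c' d, s')) (step (c, s)))"
| "step (If b c d, s) = return_pmf (if bval b s then c else d, s)"
| "step (While b c, s) = return_pmf (if bval b s then Seq c (While b c) else SKIP, s)"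

primrec steps :: "nat \<Rightarrow> com \<times> state \<Rightarrow> (com \<times> state) pmf" where
  "steps 0 cs = return_pmf cs"
| "steps (Suc t) cs = bind_pmf (step cs) (steps t)"

text \<open>Termination within \<open>t\<close> steps is required for every outcome of the coin flips.\<close>

definition halts_within :: "nat \<Rightarrow> com \<Rightarrow> state \<Rightarrow> bool" where
  "halts_within t c s \<longleftrightarrow> (\<forall>cs \<in> set_pmf (steps t (c, s)). fst cs = SKIP)"


subsection \<open>Input and output\<close>

text \<open>
  The input permutations \<open>ps\<close> are stored consecutively in the array \<open>P\<close>, the weight of \<open>e \<in> [n]\<close> is
  stored in cell \<open>e\<close> of the real array \<open>w\<close>, and all other cells are 0.
\<close>

definition input_state :: "nat \<Rightarrow> nat list list \<Rightarrow> (nat \<Rightarrow> real) \<Rightarrow> state" where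
  "input_state n ps w = \<lparr>
     nats = (\<lambda>a i.
       if a = ''n'' \<and> i = 0 then n
       else if a = ''m'' \<and> i = 0 then length ps
       else if a = ''P'' \<and> i < length (concat ps) then concat ps ! i
       else 0),
     reals = (\<lambda>a i. if a = ''w'' \<and> i \<in> {1..n} then w i else 0)\<rparr>"

definition input_size :: "nat \<Rightarrow> nat list list \<Rightarrow> nat" where
  "input_size n ps = length ps * n + n"

definition output_list :: "nat \<Rightarrow> state \<Rightarrow> nat list" where
  "output_list n s = map (nats s ''y'') [0..<n]"

end

theory Submission
  imports Defs
begin

text \<open>
  Fix an optimal median \<open>x\<close> and, for each input \<open>p\<^sub>j\<close>, a heaviest common subsequence \<open>X\<^sub>j\<close> of \<open>x\<close> and
  \<open>p\<^sub>j\<close>. Let \<open>f e\<close> be the fraction of the \<open>j\<close> with \<open>e \<notin> X\<^sub>j\<close>, and put \<open>F = (\<Sum>e. w e * f e)\<close>, which is the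
  optimal cost, and \<open>Q = (\<Sum>e. w e * (f e)\<^sup>2)\<close>. Since \<open>X\<^sub>i \<inter> X\<^sub>j\<close> is common to \<open>p\<^sub>i\<close> and \<open>p\<^sub>j\<close>, the average
  cost of an input permutation is at most \<open>2 * F - Q\<close>.

  If the majority of the inputs orders \<open>a\<close> and \<open>b\<close> differently from \<open>x\<close>, then \<open>f a + f b \<ge> 1 / 2\<close>. Hence
  \<open>(f a)\<^sup>2 + (f b)\<^sup>2 + (f c)\<^sup>2 \<ge> 1 / 8\<close> for every cyclic triple of the majority tournament. The local-ratio
  method repeatedly subtracts the minimum weight of a cyclic triple from its three members. The
  elements \<open>R\<close> of positive residual weight then carry no cycle; order them by majority and append the
  remaining elements. On \<open>R\<close> without the elements with \<open>f e \<ge> 1 / 4\<close> this agrees with \<open>x\<close>, and the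
  discarded elements weigh at most \<open>24 * Q\<close>: the price \<open>24 * (f e)\<^sup>2\<close> adds up to at least 3 on a cyclic
  triple and is at least 1 where \<open>f e \<ge> 1 / 4\<close>. So this permutation costs at most \<open>F + 24 * Q\<close>, and the
  best of all candidates at most
  \<open>1 / 25 * (F + 24 * Q) + 24 / 25 * (2 * F - Q) = 1.96 * F\<close>. The algorithm uses no random bits.
\<close>


section \<open>Common subsequences as order-preserving sets\<close>

definition bef :: "'a list \<Rightarrow> 'a \<Rightarrow> 'a \<Rightarrow> bool" where
  "bef p a b \<longleftrightarrow> (\<exists>i j. i < j \<and> j < length p \<and> p ! i = a \<and> p ! j = b)"

text \<open>One implication is enough: for distinct lists over the same elements, totality and
  asymmetry of \<open>bef\<close> give the converse. For \<open>X\<close> inside the common element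
  set, \<open>agree p q X\<close> thus says that \<open>X\<close> carries a common
  subsequence.\<close>

definition agree :: "'a list \<Rightarrow> 'a list \<Rightarrow> 'a set \<Rightarrow> bool" where
  "agree p q X \<longleftrightarrow> (\<forall>a\<in>X. \<forall>b\<in>X. bef p a b \<longrightarrow> bef q a b)"

lemma bef_nth:
  assumes "distinct p" "i < length p" "j < length p"
  shows "bef p (p ! i) (p ! j) \<longleftrightarrow> i < j"
  using assms nth_eq_iff_index_eq[OF assms(1)] unfolding bef_def
  by (metis order_less_trans)

lemma bef_irrefl: "distinct p \<Longrightarrow> \<not> bef p a a"
  unfolding bef_def by (metis nth_eq_iff_index_eq order_less_irrefl order_less_trans)

lemma bef_in_set: "bef p a b \<Longrightarrow> a \<in> set p" "bef p a b \<Longrightarrow> b \<in> set p"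
  unfolding bef_def by force+

lemma bef_trans:
  assumes "distinct p" "bef p a b" "bef p b c"
  shows "bef p a c"
  using assms unfolding bef_def by (metis nth_eq_iff_index_eq order_less_trans)

lemma bef_total:
  assumes "a \<in> set p" "b \<in> set p" "a \<noteq> b"
  shows "bef p a b \<or> bef p b a"
  using assms unfolding bef_def in_set_conv_nth by (metis linorder_neqE_nat)

lemma bef_asym: "distinct p \<Longrightarrow> bef p a b \<Longrightarrow> \<not> bef p b a"
  using bef_trans bef_irrefl by metis

text \<open>Translates precedence into \<open>subseq\<close>, whose transitivity and compatibility
  with \<open>filter\<close> drive the next proofs.\<close>

lemma bef_iff_subseq:
  assumes "distinct p"
  shows "bef p a b \<longleftrightarrow> subseq [a, b] p"
proof
  assume "bef p a b"
  then obtain i j where ij: "i < j" "j < length p" "p ! i = a" "p ! j = b"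
    unfolding bef_def by blast
  have "p = take i p @ a # drop (Suc i) p"
    using ij id_take_nth_drop[of i p] by simp
  moreover have "b \<in> set (drop (Suc i) p)"
    using ij by (auto simp: in_set_conv_nth intro!: exI[of _ "j - Suc i"])
  then have "subseq [b] (drop (Suc i) p)" by (simp add: subseq_singleton_left)
  ultimately show "subseq [a, b] p"
    by (metis subseq_Cons2 list_emb_append2)
next
  assume "subseq [a, b] p"
  then have "\<exists>us vs. p = us @ a # vs \<and> b \<in> set vs"
    using list_emb_ConsD[of "(=)" a "[b]" p] by (auto simp: subseq_singleton_left)
  then obtain us vs where p: "p = us @ a # vs" "b \<in> set vs" by blast
  then obtain k where k: "k < length vs" "vs ! k = b" by (auto simp: in_set_conv_nth)
  show "bef p a b"
    unfolding bef_def p(1) using k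
    by (intro exI[of _ "length us"] exI[of _ "length us + Suc k"]) (simp add: nth_append)
qed

text \<open>By distinctness, filtering \<open>p\<close> by \<open>set C\<close> returns
  \<open>C\<close> itself. So \<open>[a, b]\<close> embeds into \<open>C\<close>, and through
  \<open>C\<close> into \<open>q\<close>.\<close>

lemma agree_subseq:
  assumes "distinct p" "distinct q" "subseq C p" "subseq C q"
  shows "agree p q (set C)"
  unfolding agree_def
proof (intro ballI impI)
  fix a b assume ab: "a \<in> set C" "b \<in> set C" "bef p a b"
  then have "subseq (filter (\<lambda>x. x \<in> set C) [a, b]) (filter (\<lambda>x. x \<in> set C) p)"
    using assms(1) by (intro subseq_filter) (simp add: bef_iff_subseq)
  then have "subseq [a, b] C"
    using ab subseq_distinct_filter[OF assms(3,1)] by simp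
  with assms(2,4) show "bef q a b"
    by (meson bef_iff_subseq subseq_order.order_trans)
qed

lemma bef_filter:
  assumes "distinct p" "bef (filter Q p) a b"
  shows "bef p a b"
  using assms by (metis bef_iff_subseq distinct_filter subseq_filter_left subseq_order.order_trans)

text \<open>Replace each element by its position \<open>f\<close> in \<open>q\<close>. Both filtered
  lists become strictly increasing lists of numbers with the same set, hence equal, and
  \<open>f\<close> is injective on \<open>set q\<close>.\<close>

lemma filter_eq_if_agree:
  assumes "distinct p" "distinct q" "set p = set q" "agree p q X"
  shows "filter (\<lambda>x. x \<in> X) p = filter (\<lambda>x. x \<in> X) q"
proof -
  let ?p = "filter (\<lambda>x. x \<in> X) p" and ?q = "filter (\<lambda>x. x \<in> X) q"
  define f where "f a = (SOME i. i < length q \<and> q ! i = a)" for a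
  have f: "f a < length q \<and> q ! f a = a" if "a \<in> set q" for a
    unfolding f_def using that by (intro someI_ex[of "\<lambda>i. i < length q \<and> q ! i = a"]) (auto simp: in_set_conv_nth)
  have fb: "f a < f b" if "bef q a b" for a b
  proof -
    from that have "a \<in> set q" "b \<in> set q" by (auto dest: bef_in_set)
    then show ?thesis using that f[of a] f[of b] bef_nth[OF assms(2), of "f a" "f b"] by simp
  qed
  have srt: "sorted_wrt (<) (map f l)" if "distinct l" "set l \<subseteq> set q" "\<And>a b. bef l a b \<Longrightarrow> bef q a b" for l
    unfolding sorted_wrt_iff_nth_less
  proof (intro allI impI)
    fix i j assume ij: "i < j" "j < length (map f l)"
    then have "bef l (l ! i) (l ! j)" using bef_nth[OF that(1), of i j] by simp
    then show "map f l ! i < map f l ! j" using ij fb that(3) by simp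
  qed
  have "sorted_wrt (<) (map f ?p)"
  proof (rule srt)
    fix a b assume ab: "bef ?p a b"
    then have "a \<in> X" "b \<in> X" by (auto dest: bef_in_set)
    with ab assms show "bef q a b" unfolding agree_def by (meson bef_filter)
  qed (use assms in auto)
  moreover have "sorted_wrt (<) (map f ?q)"
    by (rule srt) (use assms in \<open>auto intro: bef_filter\<close>)
  moreover have "set (map f ?p) = set (map f ?q)" using assms(3) by auto
  ultimately have "map f ?p = map f ?q"
    by (meson strict_sorted_equal)
  moreover have "inj_on f (set q)" by (rule inj_on_inverseI[of _ "(!) q"]) (simp add: f)
  then have "inj_on f (set ?p \<union> set ?q)"
    by (rule inj_on_subset) (use assms(3) in auto)
  ultimately show ?thesis by (simp only: inj_on_map_eq_map)
qed

section \<open>The weighted distance in terms of order-preserving sets\<close>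

lemma permsD: "p \<in> perms n \<Longrightarrow> distinct p \<and> set p = {1..n} \<and> length p = n"
  by (auto simp: permutations_of_setD length_finite_permutations_of_set)

context
  fixes n :: nat and w :: "nat \<Rightarrow> real" and p q :: "nat list"
  assumes pq: "p \<in> perms n" "q \<in> perms n"
    and wpos: "\<And>e. e \<in> {1..n} \<Longrightarrow> w e > 0"
begin

text \<open>This bound and the attaining set of the next lemma are the only access to the distance
  from here on; common subsequences as lists no longer appear.\<close>

lemma ulam_dist_le_agree:
  assumes X: "X \<subseteq> {1..n}" "agree p q X"
  shows "ulam_dist w p q \<le> sum w {1..n} - sum w X"
proof -
  let ?M = "{\<Sum>e\<in>set C. w e |C. subseq C p \<and> subseq C q}"
  have "?M \<subseteq> (\<lambda>C. \<Sum>e\<in>set C. w e) ` {C. subseq C p}" by auto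
  moreover have "finite {C. subseq C p}"
    unfolding set_subseqs_eq[symmetric] by (rule List.finite_set)
  ultimately have fin: "finite ?M" using finite_surj by blast
  have eq: "filter (\<lambda>x. x \<in> X) p = filter (\<lambda>x. x \<in> X) q"
    using permsD[OF pq(1)] permsD[OF pq(2)] X by (intro filter_eq_if_agree) auto
  have "set (filter (\<lambda>x. x \<in> X) p) = X" using X permsD[OF pq(1)] by auto
  then have "sum w X \<in> ?M"
    using eq subseq_filter_left[of "\<lambda>x. x \<in> X" p] subseq_filter_left[of "\<lambda>x. x \<in> X" q]
    by (intro CollectI exI[of _ "filter (\<lambda>x. x \<in> X) p"]) simp
  from Max_ge[OF fin this] show ?thesis
    using ulam_dist_common_subseq[OF pq wpos] by simp
qed

lemma ulam_dist_agree_obtains: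
  obtains X where "X \<subseteq> {1..n}" "agree p q X" "ulam_dist w p q = sum w {1..n} - sum w X"
proof -
  let ?M = "{\<Sum>e\<in>set C. w e |C. subseq C p \<and> subseq C q}"
  have "?M \<subseteq> (\<lambda>C. \<Sum>e\<in>set C. w e) ` {C. subseq C p}" by auto
  moreover have "finite {C. subseq C p}"
    unfolding set_subseqs_eq[symmetric] by (rule List.finite_set)
  ultimately have fin: "finite ?M" using finite_surj by blast
  have "subseq [] p \<and> subseq [] q" by simp
  then have ne: "?M \<noteq> {}" by blast
  from Max_in[OF fin ne] obtain C where C: "subseq C p" "subseq C q"
    and CM: "Max ?M = (\<Sum>e\<in>set C. w e)" by auto
  have "set C \<subseteq> {1..n}" using subseq_set[OF C(1)] permsD[OF pq(1)] by simp
  moreover have "agree p q (set C)"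
    using C permsD[OF pq(1)] permsD[OF pq(2)] by (intro agree_subseq) auto
  ultimately show thesis
    using that[of "set C"] ulam_dist_common_subseq[OF pq wpos] CM by simp
qed

end

section \<open>The majority tournament and the local-ratio bound\<close>

lemma agree_ulam_le:
  assumes "p \<in> perms n" "q \<in> perms n" "\<And>e. e \<in> {1..n} \<Longrightarrow> w e > 0"
    and "X \<subseteq> {1..n}" "agree p q X"
  shows "ulam_dist w p q \<le> (\<Sum>e=1..n. w e * of_bool (e \<notin> X))"
proof -
  have "(\<Sum>e=1..n. w e * of_bool (e \<notin> X)) = sum w ({1..n} - X)"
    by (rule sum.mono_neutral_cong_right) auto
  also have "\<dots> = sum w {1..n} - sum w X"
    using assms(4) by (simp add: sum_diff)
  finally show ?thesis using ulam_dist_le_agree[OF assms] by simp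
qed

text \<open>For \<open>A i\<close> the indicator of \<open>e \<in> X i\<close> and \<open>c\<close>
  the weight of \<open>e\<close>, the left side is the total price of \<open>e\<close> over all
  ordered pairs of inputs whose sets \<open>X i\<close>, \<open>X j\<close> do not both contain
  \<open>e\<close>.\<close>

lemma sum_sum_complement_product:
  fixes A :: "nat \<Rightarrow> real"
  shows "(\<Sum>i<m. \<Sum>j<m. c * (1 - A i * A j)) = c * ((real m)\<^sup>2 - (\<Sum>i<m. A i) * (\<Sum>j<m. A j))"
  unfolding sum_product sum_distrib_left[symmetric] sum_subtractf
  by (simp add: power2_eq_square)

definition cnt :: "'a list list \<Rightarrow> 'a \<Rightarrow> 'a \<Rightarrow> nat" where
  "cnt ps a b = (\<Sum>j<length ps. of_bool (bef (ps ! j) a b))"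

text \<open>The term \<open>of_bool (a < b)\<close> breaks ties, so that \<open>maj\<close> is a tournament.\<close>

definition maj :: "'a::linorder list list \<Rightarrow> 'a \<Rightarrow> 'a \<Rightarrow> bool" where
  "maj ps a b \<longleftrightarrow> length ps < 2 * cnt ps a b + of_bool (a < b)"

definition cyclic :: "'a::linorder list list \<Rightarrow> 'a \<Rightarrow> 'a \<Rightarrow> 'a \<Rightarrow> bool" where
  "cyclic ps a b c \<longleftrightarrow> maj ps a b \<and> maj ps b c \<and> maj ps c a"

text \<open>
  The cost \<open>w - r\<close> spent so far is a nonnegative combination of indicators of cyclic triples; the
  second conjunct is the consequence of this that the analysis needs, for every price \<open>\<phi>\<close> at which
  a cyclic triple costs at least 3.
\<close>

definition partial_cover :: "nat list list \<Rightarrow> nat \<Rightarrow> (nat \<Rightarrow> real) \<Rightarrow> (nat \<Rightarrow> real) \<Rightarrow> bool" where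
  "partial_cover ps n w r \<longleftrightarrow>
     (\<forall>e\<in>{1..n}. 0 \<le> r e \<and> r e \<le> w e) \<and>
     (\<forall>\<phi>::nat \<Rightarrow> real.
        (\<forall>a\<in>{1..n}. \<forall>b\<in>{1..n}. \<forall>c\<in>{1..n}. cyclic ps a b c \<longrightarrow> 3 \<le> \<phi> a + \<phi> b + \<phi> c) \<longrightarrow>
        (\<Sum>e=1..n. w e - r e) \<le> (\<Sum>e=1..n. (w e - r e) * \<phi> e))"

definition acyclic_support :: "nat list list \<Rightarrow> nat \<Rightarrow> (nat \<Rightarrow> real) \<Rightarrow> bool" where
  "acyclic_support ps n r \<longleftrightarrow>
     (\<forall>a\<in>{1..n}. \<forall>b\<in>{1..n}. \<forall>c\<in>{1..n}. cyclic ps a b c \<longrightarrow> r a = 0 \<or> r b = 0 \<or> r c = 0)"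

definition total_dist :: "('a \<Rightarrow> real) \<Rightarrow> 'a list list \<Rightarrow> 'a list \<Rightarrow> real" where
  "total_dist w ps x = (\<Sum>j<length ps. ulam_dist w x (ps ! j))"

context
  fixes n :: nat and ps :: "nat list list"
  assumes ps: "ps \<noteq> []" "set ps \<subseteq> perms n"
begin

lemma nth_perms: "j < length ps \<Longrightarrow> ps ! j \<in> perms n"
  using ps(2) nth_mem by blast

lemma cnt_add:
  assumes "a \<in> {1..n}" "b \<in> {1..n}" "a \<noteq> b"
  shows "cnt ps a b + cnt ps b a = length ps"
proof -
  have "of_bool (bef (ps ! j) a b) + of_bool (bef (ps ! j) b a) = (1::nat)" if "j < length ps" for j
    using bef_total[of a "ps ! j" b] bef_asym[of "ps ! j" a b] assms permsD[OF nth_perms[OF that]]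
    by auto
  then show ?thesis unfolding cnt_def sum.distrib[symmetric] by simp
qed

text \<open>By \<open>cnt_add\<close>, the two quantities compared with \<open>length ps\<close> in
  \<open>maj ps a b\<close> and \<open>maj ps b a\<close> add up to
  \<open>2 * length ps + 1\<close>, so exactly one of them exceeds \<open>length ps\<close>. The
  same count gives asymmetry.\<close>

lemma maj_total:
  assumes "a \<in> {1..n}" "b \<in> {1..n}" "a \<noteq> b"
  shows "maj ps a b \<or> maj ps b a"
  using cnt_add[OF assms] assms(3) unfolding maj_def by auto

lemma maj_asym:
  assumes "a \<in> {1..n}" "b \<in> {1..n}" "maj ps a b"
  shows "\<not> maj ps b a"
proof (cases "a = b")
  \<comment> \<open>This case yields irreflexivity of \<open>maj\<close>, which later rules out
    cyclic triples with repeated elements.\<close>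
  case True
  have "\<not> bef (ps ! j) a a" if "j < length ps" for j
    using bef_irrefl permsD[OF nth_perms[OF that]] by metis
  then have "cnt ps a a = 0" unfolding cnt_def by simp
  then show ?thesis using True unfolding maj_def by simp
next
  case False
  then show ?thesis using cnt_add[OF assms(1,2)] assms(3) unfolding maj_def by (auto split: if_splits simp: of_bool_def)
qed

section \<open>Analysis relative to a fixed permutation \<open>x\<close> with sets
  \<open>X j\<close> attaining its distances\<close>

context
  fixes w :: "nat \<Rightarrow> real" and x :: "nat list" and X :: "nat \<Rightarrow> nat set"
  assumes wpos: "\<And>e. e \<in> {1..n} \<Longrightarrow> w e > 0"
    and x: "x \<in> perms n"
    and X: "\<And>j. j < length ps \<Longrightarrow> X j \<subseteq> {1..n}" "\<And>j. j < length ps \<Longrightarrow> agree x (ps ! j) (X j)"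
      "\<And>j. j < length ps \<Longrightarrow> ulam_dist w x (ps ! j) = sum w {1..n} - sum w (X j)"
begin

definition frac :: "nat \<Rightarrow> real" where
  "frac e = (\<Sum>j<length ps. of_bool (e \<notin> X j)) / length ps"

lemma length_ps_pos: "0 < real (length ps)"
  using ps(1) by simp

lemma sum_of_bool_frac: "(\<Sum>j<length ps. of_bool (e \<notin> X j)) = length ps * frac e"
  unfolding frac_def using ps(1) by simp

text \<open>Double counting: input \<open>j\<close> pays for exactly the elements outside
  \<open>X j\<close>; summing over the inputs first gives each element the factor
  \<open>frac\<close>.\<close>

lemma total_dist_frac: "total_dist w ps x = length ps * (\<Sum>e=1..n. w e * frac e)"
proof -
  have "ulam_dist w x (ps ! j) = (\<Sum>e=1..n. w e * of_bool (e \<notin> X j))" if "j < length ps" for j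
  proof -
    have "(\<Sum>e=1..n. w e * of_bool (e \<notin> X j)) = sum w ({1..n} - X j)"
      by (rule sum.mono_neutral_cong_right) auto
    also have "\<dots> = sum w {1..n} - sum w (X j)"
      using X(1)[OF that] by (simp add: sum_diff)
    finally show ?thesis using X(3)[OF that] by simp
  qed
  then have "total_dist w ps x = (\<Sum>j<length ps. \<Sum>e=1..n. w e * of_bool (e \<notin> X j))"
    unfolding total_dist_def by simp
  also have "\<dots> = (\<Sum>e=1..n. w e * (\<Sum>j<length ps. of_bool (e \<notin> X j)))"
    by (subst sum.swap) (simp add: sum_distrib_left mult.commute)
  also have "\<dots> = length ps * (\<Sum>e=1..n. w e * frac e)"
    unfolding sum_of_bool_frac by (simp add: sum_distrib_left mult_ac)
  finally show ?thesis .
qed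

text \<open>An input that places \<open>a\<close> before \<open>b\<close> contradicts
  \<open>x\<close> on this pair, so its \<open>X j\<close> misses \<open>a\<close> or
  \<open>b\<close>. At least half of the inputs are of this kind.\<close>

lemma frac_wrong_pair:
  assumes ab: "a \<in> {1..n}" "b \<in> {1..n}" and "maj ps a b" "\<not> bef x a b"
  shows "1 / 2 \<le> frac a + frac b"
proof -
  have "a \<noteq> b" using maj_asym[of a a] assms by blast
  then have ba: "bef x b a"
    using bef_total[of a x b] assms permsD[OF x] by auto
  have le: "of_bool (bef (ps ! j) a b) \<le> (of_bool (a \<notin> X j) + of_bool (b \<notin> X j) :: real)"
    if "j < length ps" for j
    using X(2)[OF that] ba bef_asym[of "ps ! j" a b] permsD[OF nth_perms[OF that]]
    unfolding agree_def by (auto simp: of_bool_def)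
  have "real (cnt ps a b) = (\<Sum>j<length ps. of_bool (bef (ps ! j) a b))"
    unfolding cnt_def by simp
  also have "\<dots> \<le> length ps * frac a + length ps * frac b"
    unfolding sum_of_bool_frac[symmetric] sum.distrib[symmetric]
    using le by (intro sum_mono) auto
  finally have "real (cnt ps a b) \<le> length ps * (frac a + frac b)"
    by (simp add: algebra_simps)
  \<comment> \<open>A tie won through \<open>a < b\<close> still means exactly half of the inputs,
    hence the non-strict bound.\<close>
  moreover have "length ps \<le> 2 * cnt ps a b"
    using assms(3) unfolding maj_def by (auto simp: of_bool_def split: if_splits)
  then have "real (length ps) \<le> 2 * real (cnt ps a b)" by linarith
  ultimately have "length ps * (1 / 2) \<le> length ps * (frac a + frac b)" by linarith
  then show ?thesis using length_ps_pos by (simp only: mult_le_cancel_left_pos)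
qed

text \<open>Two numbers with sum at least 1/2 have squares adding up to at least half of
  1/4.\<close>

lemma sum_squares_wrong_pair:
  assumes "a \<in> {1..n}" "b \<in> {1..n}" "maj ps a b" "\<not> bef x a b"
  shows "1 / 8 \<le> (frac a)\<^sup>2 + (frac b)\<^sup>2"
proof -
  have "(1 / 2)\<^sup>2 \<le> (frac a + frac b)\<^sup>2"
    using frac_wrong_pair[OF assms] by (intro power_mono) auto
  also have "\<dots> \<le> 2 * ((frac a)\<^sup>2 + (frac b)\<^sup>2)"
    using sum_squares_bound[of "frac a" "frac b"] by (simp add: power2_sum)
  finally show ?thesis by (simp add: power2_eq_square)
qed

text \<open>The linear order \<open>x\<close> cannot follow all three edges of the cycle, so one
  edge is a wrong pair. The factor 24 lifts its 1/8 to the price 3 demanded by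
  \<open>partial_cover\<close>.\<close>

lemma sum_squares_cyclic:
  assumes "a \<in> {1..n}" "b \<in> {1..n}" "c \<in> {1..n}" "cyclic ps a b c"
  shows "3 \<le> 24 * (frac a)\<^sup>2 + 24 * (frac b)\<^sup>2 + 24 * (frac c)\<^sup>2"
proof -
  have "\<not> (bef x a b \<and> bef x b c \<and> bef x c a)"
    using bef_trans bef_irrefl permsD[OF x] by metis
  then have "1 / 8 \<le> (frac a)\<^sup>2 + (frac b)\<^sup>2 \<or> 1 / 8 \<le> (frac b)\<^sup>2 + (frac c)\<^sup>2 \<or> 1 / 8 \<le> (frac c)\<^sup>2 + (frac a)\<^sup>2"
    using sum_squares_wrong_pair assms unfolding cyclic_def by metis
  then show ?thesis
    using zero_le_power2[of "frac a"] zero_le_power2[of "frac b"] zero_le_power2[of "frac c"]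
    by argo
qed

lemma total_dist_majority:
  assumes r: "partial_cover ps n w r" and y: "y \<in> perms n"
    and yr: "\<And>a b. a \<in> {1..n} \<Longrightarrow> b \<in> {1..n} \<Longrightarrow> 0 < r a \<Longrightarrow> 0 < r b \<Longrightarrow> maj ps a b \<Longrightarrow> bef y a b"
  shows "total_dist w ps y \<le>
    length ps * ((\<Sum>e=1..n. w e * frac e) + 24 * (\<Sum>e=1..n. w e * (frac e)\<^sup>2))"
proof -
  \<comment> \<open>Two elements below 1/4 cannot form a wrong pair, so on \<open>Z\<close> majority
    order, \<open>x\<close> and \<open>y\<close> coincide.\<close>
  define Z where "Z = {e \<in> {1..n}. 0 < r e \<and> frac e < 1 / 4}"
  have r0: "0 \<le> r e" "r e \<le> w e" if "e \<in> {1..n}" for e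
    using r that unfolding partial_cover_def by auto
  have agr: "agree y (ps ! j) (Z \<inter> X j)" if j: "j < length ps" for j
    unfolding agree_def
  proof (intro ballI impI)
    fix a b assume ab: "a \<in> Z \<inter> X j" "b \<in> Z \<inter> X j" "bef y a b"
    then have ne: "a \<noteq> b" using bef_irrefl permsD[OF y] by metis
    have "\<not> maj ps b a"
    proof
      assume "maj ps b a"
      then have "bef y b a" using yr[of b a] ab unfolding Z_def by auto
      then show False using bef_asym permsD[OF y] ab(3) by metis
    qed
    then have "maj ps a b" using maj_total[of a b] ab ne unfolding Z_def by auto
    then have "bef x a b"
      using frac_wrong_pair[of a b] ab unfolding Z_def by force
    then show "bef (ps ! j) a b" using X(2)[OF j] ab unfolding agree_def by blast
  qed
  have "ulam_dist w y (ps ! j) \<le> (\<Sum>e=1..n. w e * of_bool (e \<notin> X j)) + (\<Sum>e=1..n. w e * of_bool (e \<notin> Z))"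
    if j: "j < length ps" for j
  proof -
    have "ulam_dist w y (ps ! j) \<le> (\<Sum>e=1..n. w e * of_bool (e \<notin> Z \<inter> X j))"
      using agr[OF j] nth_perms[OF j] y wpos unfolding Z_def by (intro agree_ulam_le) auto
    also have "\<dots> \<le> (\<Sum>e=1..n. w e * of_bool (e \<notin> X j) + w e * of_bool (e \<notin> Z))"
      using wpos by (intro sum_mono) (auto simp: of_bool_def order_less_imp_le)
    finally show ?thesis by (simp add: sum.distrib)
  qed
  then have "total_dist w ps y \<le>
    (\<Sum>j<length ps. (\<Sum>e=1..n. w e * of_bool (e \<notin> X j)) + (\<Sum>e=1..n. w e * of_bool (e \<notin> Z)))"
    unfolding total_dist_def by (intro sum_mono) auto
  also have "\<dots> = (\<Sum>e=1..n. w e * (\<Sum>j<length ps. of_bool (e \<notin> X j))) +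
      length ps * (\<Sum>e=1..n. w e * of_bool (e \<notin> Z))"
    unfolding sum.distrib by (subst sum.swap) (simp add: sum_distrib_left mult.commute)
  also have "\<dots> = length ps * ((\<Sum>e=1..n. w e * frac e) + (\<Sum>e=1..n. w e * of_bool (e \<notin> Z)))"
    unfolding sum_of_bool_frac by (simp add: sum_distrib_left mult_ac distrib_left)
  finally have 1: "total_dist w ps y \<le> \<dots>" .
  \<comment> \<open>An element outside \<open>Z\<close> has either no residual weight, and then
    \<open>w e - r e\<close> pays for it in full, or \<open>frac e \<ge> 1 / 4\<close>, and then
    \<open>24 * (frac e)\<^sup>2\<close> is at least 3/2 and covers \<open>r e\<close>.\<close>
  have "w e * of_bool (e \<notin> Z) \<le> (w e - r e) + r e * (24 * (frac e)\<^sup>2)" if e: "e \<in> {1..n}" for e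
  proof (cases "e \<in> Z")
    case True
    then show ?thesis using r0[OF e] by simp
  next
    case False
    show ?thesis
    proof (cases "0 < r e")
      case True
      with False e have "1 / 4 \<le> frac e" unfolding Z_def by simp
      then have "(1 / 4)\<^sup>2 \<le> (frac e)\<^sup>2" by (intro power_mono) auto
      then have "1 \<le> 24 * (frac e)\<^sup>2" by (simp add: power2_eq_square)
      then have "r e * 1 \<le> r e * (24 * (frac e)\<^sup>2)" using True by (intro mult_left_mono) auto
      then show ?thesis using False by simp
    next
      case False2: False
      then have "r e = 0" using r0[OF e] by simp
      then show ?thesis using False by simp
    qed
  qed
  then have "(\<Sum>e=1..n. w e * of_bool (e \<notin> Z)) \<le> (\<Sum>e=1..n. (w e - r e) + r e * (24 * (frac e)\<^sup>2))"
    by (intro sum_mono) auto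
  also have "\<dots> = (\<Sum>e=1..n. w e - r e) + (\<Sum>e=1..n. r e * (24 * (frac e)\<^sup>2))"
    by (rule sum.distrib)
  \<comment> \<open>The covering property is instantiated with the price
    \<open>24 * (frac e)\<^sup>2\<close>.\<close>
  also have "\<dots> \<le> (\<Sum>e=1..n. (w e - r e) * (24 * (frac e)\<^sup>2)) + (\<Sum>e=1..n. r e * (24 * (frac e)\<^sup>2))"
    using r sum_squares_cyclic unfolding partial_cover_def by (intro add_right_mono) simp
  also have "\<dots> = 24 * (\<Sum>e=1..n. w e * (frac e)\<^sup>2)"
    unfolding sum.distrib[symmetric] sum_distrib_left by (intro sum.cong) (auto simp: algebra_simps)
  finally have 2: "(\<Sum>e=1..n. w e * of_bool (e \<notin> Z)) \<le> 24 * (\<Sum>e=1..n. w e * (frac e)\<^sup>2)" .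
  show ?thesis
    using 1 mult_left_mono[OF add_left_mono[OF 2, of "\<Sum>e=1..n. w e * frac e"], of "real (length ps)"]
    by linarith
qed

text \<open>On \<open>X i \<inter> X j\<close> both inputs follow \<open>x\<close>. Over all ordered
  pairs, \<open>e\<close> lies outside this intersection with frequency
  \<open>1 - (1 - frac e)\<^sup>2\<close>, which equals
  \<open>2 * frac e - (frac e)\<^sup>2\<close>.\<close>

lemma sum_total_dist_inputs:
  "(\<Sum>i<length ps. total_dist w ps (ps ! i)) \<le>
    (real (length ps))\<^sup>2 * (2 * (\<Sum>e=1..n. w e * frac e) - (\<Sum>e=1..n. w e * (frac e)\<^sup>2))"
proof -
  have agr: "agree (ps ! i) (ps ! j) (X i \<inter> X j)" if ij: "i < length ps" "j < length ps" for i j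
    unfolding agree_def
  proof (intro ballI impI)
    fix a b assume ab: "a \<in> X i \<inter> X j" "b \<in> X i \<inter> X j" "bef (ps ! i) a b"
    have d: "distinct (ps ! i)" using permsD nth_perms ij by blast
    then have "a \<noteq> b" using bef_irrefl ab(3) by metis
    moreover have "a \<in> set x" "b \<in> set x" using X(1)[OF ij(1)] ab permsD[OF x] by auto
    moreover have "\<not> bef x b a"
      using X(2)[OF ij(1)] ab bef_asym[OF d] unfolding agree_def by blast
    ultimately have "bef x a b" using bef_total by metis
    then show "bef (ps ! j) a b" using X(2)[OF ij(2)] ab unfolding agree_def by blast
  qed
  have ob: "of_bool (e \<notin> X i \<inter> X j) = 1 - (1 - of_bool (e \<notin> X i)) * (1 - of_bool (e \<notin> X j) :: real)" for e i j
    by (auto simp: of_bool_def)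
  have s: "(\<Sum>i<length ps. 1 - of_bool (e \<notin> X i)) = length ps * (1 - frac e)" for e
    unfolding sum_subtractf sum_of_bool_frac by (simp add: algebra_simps)
  have "(\<Sum>i<length ps. total_dist w ps (ps ! i)) \<le>
    (\<Sum>i<length ps. \<Sum>j<length ps. \<Sum>e=1..n. w e * of_bool (e \<notin> X i \<inter> X j))"
    unfolding total_dist_def using agr nth_perms wpos X(1)
    by (intro sum_mono agree_ulam_le) (blast | simp)+
  also have "\<dots> = (\<Sum>e=1..n. \<Sum>i<length ps. \<Sum>j<length ps. w e * of_bool (e \<notin> X i \<inter> X j))"
    by (simp only: sum.swap[of _ "{1..n}"])
  also have "\<dots> = (\<Sum>e=1..n. (real (length ps))\<^sup>2 * (2 * (w e * frac e) - w e * (frac e)\<^sup>2))"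
  proof (rule sum.cong[OF refl])
    fix e
    have "(\<Sum>i<length ps. \<Sum>j<length ps. w e * of_bool (e \<notin> X i \<inter> X j)) =
      w e * ((real (length ps))\<^sup>2 - (\<Sum>i<length ps. 1 - of_bool (e \<notin> X i)) * (\<Sum>j<length ps. 1 - of_bool (e \<notin> X j) :: real))"
      unfolding ob by (rule sum_sum_complement_product)
    also have "\<dots> = (real (length ps))\<^sup>2 * (2 * (w e * frac e) - w e * (frac e)\<^sup>2)"
      unfolding s by (simp add: power2_eq_square algebra_simps)
    finally show "(\<Sum>i<length ps. \<Sum>j<length ps. w e * of_bool (e \<notin> X i \<inter> X j)) = \<dots>" .
  qed
  finally show ?thesis by (simp only: sum_distrib_left[symmetric] sum_subtractf)
qed

lemma best_candidate_aux:
  assumes "partial_cover ps n w r" "y \<in> perms n"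
    and "\<And>a b. a \<in> {1..n} \<Longrightarrow> b \<in> {1..n} \<Longrightarrow> 0 < r a \<Longrightarrow> 0 < r b \<Longrightarrow> maj ps a b \<Longrightarrow> bef y a b"
  shows "\<exists>z \<in> insert y (set ps). 25 * total_dist w ps z \<le> 49 * total_dist w ps x"
proof (rule ccontr)
  define F where "F = (\<Sum>e=1..n. w e * frac e)"
  define Q where "Q = (\<Sum>e=1..n. w e * (frac e)\<^sup>2)"
  define m where "m = real (length ps)"
  have m: "0 < m" unfolding m_def by (rule length_ps_pos)
  assume neg: "\<not> ?thesis"
  have tx: "total_dist w ps x = m * F" unfolding m_def F_def by (rule total_dist_frac)
  have "49 * (m * F) < 25 * total_dist w ps y" using neg tx by auto
  also have "\<dots> \<le> 25 * (m * (F + 24 * Q))"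
    using total_dist_majority[OF assms] unfolding m_def F_def Q_def by simp
  finally have "m * (49 * F) < m * (25 * (F + 24 * Q))" by (simp add: algebra_simps)
  then have 1: "49 * F < 25 * (F + 24 * Q)" using m by (simp only: mult_less_cancel_left_pos)
  have "(\<Sum>i<length ps. 49 * (m * F)) < (\<Sum>i<length ps. 25 * total_dist w ps (ps ! i))"
    using neg tx ps(1) by (intro sum_strict_mono) (auto simp: not_le)
  also have "\<dots> \<le> 25 * (m\<^sup>2 * (2 * F - Q))"
    using sum_total_dist_inputs unfolding m_def F_def Q_def sum_distrib_left[symmetric] by simp
  finally have "m * m * (49 * F) < m * m * (25 * (2 * F - Q))"
    by (simp add: m_def power2_eq_square algebra_simps)
  then have 2: "49 * F < 25 * (2 * F - Q)" using m by (simp only: mult_less_cancel_left_pos mult_pos_pos)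
  \<comment> \<open>The first inequality says \<open>F < 25 * Q\<close>, the second
    \<open>25 * Q < F\<close>.\<close>
  from 1 2 show False by simp
qed

end

lemma best_candidate:
  assumes wpos: "\<And>e. e \<in> {1..n} \<Longrightarrow> w e > 0" and x: "x \<in> perms n"
    and r: "partial_cover ps n w r" and y: "y \<in> perms n"
    and yr: "\<And>a b. a \<in> {1..n} \<Longrightarrow> b \<in> {1..n} \<Longrightarrow> 0 < r a \<Longrightarrow> 0 < r b \<Longrightarrow> maj ps a b \<Longrightarrow> bef y a b"
  shows "\<exists>z \<in> insert y (set ps). 25 * total_dist w ps z \<le> 49 * total_dist w ps x"
proof -
  have "\<exists>X. X \<subseteq> {1..n} \<and> agree x (ps ! j) X \<and> ulam_dist w x (ps ! j) = sum w {1..n} - sum w X"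
    if "j < length ps" for j
    by (rule ulam_dist_agree_obtains[OF x nth_perms[OF that] wpos]) blast+
  then obtain X where X: "\<And>j. j < length ps \<Longrightarrow> X j \<subseteq> {1..n} \<and> agree x (ps ! j) (X j) \<and>
      ulam_dist w x (ps ! j) = sum w {1..n} - sum w (X j)"
    by metis
  show ?thesis
  proof (rule best_candidate_aux[of w x X r y])
    show "bef y a b" if "a \<in> {1..n}" "b \<in> {1..n}" "0 < r a" "0 < r b" "maj ps a b" for a b
      using that by (rule yr)
  qed (use X wpos x r y in simp_all)
qed

end

section \<open>Heaviest common subsequences by dynamic programming\<close>

text \<open>This recursion and \<open>running_max\<close> scan from left to right, exactly as the
  loops of the program do. The start value 0 stands for the empty chain.\<close>

primrec best_pred :: "(nat \<Rightarrow> nat \<Rightarrow> bool) \<Rightarrow> (nat \<Rightarrow> real) \<Rightarrow> nat \<Rightarrow> nat \<Rightarrow> real" where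
  "best_pred R h i 0 = 0"
| "best_pred R h i (Suc l) =
     (if R l i \<and> best_pred R h i l < h l then h l else best_pred R h i l)"

primrec running_max :: "(nat \<Rightarrow> real) \<Rightarrow> nat \<Rightarrow> real" where
  "running_max h 0 = 0"
| "running_max h (Suc k) = (if running_max h k < h k then h k else running_max h k)"

lemma best_pred_cong: "(\<And>l'. l' < l \<Longrightarrow> h l' = h' l') \<Longrightarrow> best_pred R h i l = best_pred R h' i l"
  by (induction l) auto

lemma running_max_cong: "(\<And>l'. l' < l \<Longrightarrow> h l' = h' l') \<Longrightarrow> running_max h l = running_max h' l"
  by (induction l) auto

lemma best_pred_nonneg: "0 \<le> best_pred R h i l"
  by (induction l) auto

lemma best_pred_ge: "l' < l \<Longrightarrow> R l' i \<Longrightarrow> h l' \<le> best_pred R h i l"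
  by (induction l) (auto simp: less_Suc_eq)

lemma best_pred_cases: "best_pred R h i l = 0 \<or> (\<exists>l'<l. R l' i \<and> best_pred R h i l = h l')"
  by (induction l) (auto simp: less_Suc_eq)

lemma running_max_nonneg: "0 \<le> running_max h k"
  by (induction k) auto

lemma running_max_ge: "l < k \<Longrightarrow> h l \<le> running_max h k"
  by (induction k) (auto simp: less_Suc_eq)

lemma running_max_cases: "running_max h k = 0 \<or> (\<exists>l<k. running_max h k = h l)"
  by (induction k) (auto simp: less_Suc_eq)

context
  fixes n :: nat and w :: "nat \<Rightarrow> real" and x q :: "nat list" and h :: "nat \<Rightarrow> real"
  assumes xq: "x \<in> perms n" "q \<in> perms n"
    and wpos: "\<And>e. e \<in> {1..n} \<Longrightarrow> w e > 0"
    and h: "\<And>i. i < n \<Longrightarrow> h i = w (x ! i) + best_pred (\<lambda>l i. bef q (x ! l) (x ! i)) h i i"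
begin

text \<open>Follow a predecessor that attains the maximum. The last conjunct strengthens the
  induction: everything collected so far precedes \<open>x ! i\<close> in both lists, so
  \<open>x ! i\<close> can be added at the end.\<close>

lemma chain_witness:
  assumes "i < n"
  shows "\<exists>X \<subseteq> {1..n}. agree x q X \<and> x ! i \<in> X \<and> sum w X = h i \<and>
    (\<forall>a\<in>X. a = x ! i \<or> bef x a (x ! i) \<and> bef q a (x ! i))"
  using assms
proof (induction i rule: less_induct)
  case (less i)
  note x = permsD[OF xq(1)] and q = permsD[OF xq(2)]
  have xi: "x ! i \<in> {1..n}" using x less.prems nth_mem by metis
  consider "best_pred (\<lambda>l i. bef q (x ! l) (x ! i)) h i i = 0"
    | l where "l < i" "bef q (x ! l) (x ! i)" "best_pred (\<lambda>l i. bef q (x ! l) (x ! i)) h i i = h l"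
    using best_pred_cases[of "\<lambda>l i. bef q (x ! l) (x ! i)" h i i] by blast
  then show ?case
  proof cases
    case 1
    have "\<not> bef x (x ! i) (x ! i)" using bef_irrefl x by metis
    then show ?thesis
      using 1 h[OF less.prems] xi by (intro exI[of _ "{x ! i}"]) (simp add: agree_def)
  next
    case 2
    then have "l < n" using less.prems by simp
    from less.IH[OF 2(1) this] obtain X where X: "X \<subseteq> {1..n}" "agree x q X" "x ! l \<in> X" "sum w X = h l"
      "\<And>a. a \<in> X \<Longrightarrow> a = x ! l \<or> bef x a (x ! l) \<and> bef q a (x ! l)"
      by blast
    have "bef x (x ! l) (x ! i)" using bef_nth[of x l i] x 2 less.prems by simp
    then have before: "bef x a (x ! i) \<and> bef q a (x ! i)" if "a \<in> X" for a
      using X(5)[OF that] 2(2) x q bef_trans[of x a "x ! l" "x ! i"] bef_trans[of q a "x ! l" "x ! i"] by blast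
    then have "x ! i \<notin> X" using bef_irrefl x by metis
    moreover have "agree x q (insert (x ! i) X)"
      unfolding agree_def
    proof (intro ballI impI)
      fix a b assume ab: "a \<in> insert (x ! i) X" "b \<in> insert (x ! i) X" "bef x a b"
      show "bef q a b"
      proof (cases "a = x ! i")
        case True
        then have False using ab before bef_irrefl bef_asym x by (metis insertE)
        then show ?thesis ..
      next
        case False
        then show ?thesis using ab before X(2) unfolding agree_def by auto
      qed
    qed
    moreover have "finite X" using X(1) finite_subset by blast
    ultimately show ?thesis
      using before X(1,4) xi 2(3) h[OF less.prems]
      by (intro exI[of _ "insert (x ! i) X"]) auto
  qed
qed

text \<open>Induction on the length of the prefix, for all bounds \<open>B\<close> at once. If
  \<open>x ! i \<in> X\<close>, every earlier member of \<open>X\<close> is an admissible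
  predecessor, so the induction hypothesis applies with the value of \<open>best_pred\<close> as
  bound.\<close>

lemma chain_bound:
  assumes X: "X \<subseteq> {1..n}" "agree x q X"
    and "i \<le> n" "0 \<le> B" "\<And>l. l < i \<Longrightarrow> x ! l \<in> X \<Longrightarrow> h l \<le> B"
  shows "sum w (X \<inter> (!) x ` {..<i}) \<le> B"
  using assms(3-5)
proof (induction i arbitrary: B)
  case (Suc i)
  note x = permsD[OF xq(1)]
  show ?case
  proof (cases "x ! i \<in> X")
    case False
    then have "X \<inter> (!) x ` {..<Suc i} = X \<inter> (!) x ` {..<i}" by (auto simp: lessThan_Suc)
    then show ?thesis using Suc by simp
  next
    case True
    have "h l \<le> best_pred (\<lambda>l i. bef q (x ! l) (x ! i)) h i i" if "l < i" "x ! l \<in> X" for l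
      using that X(2) True bef_nth[of x l i] x Suc.prems(1) unfolding agree_def
      by (intro best_pred_ge) auto
    then have "sum w (X \<inter> (!) x ` {..<i}) \<le> best_pred (\<lambda>l i. bef q (x ! l) (x ! i)) h i i"
      using Suc.prems(1) best_pred_nonneg by (intro Suc.IH) auto
    moreover have "X \<inter> (!) x ` {..<Suc i} = insert (x ! i) (X \<inter> (!) x ` {..<i})"
      using True by (auto simp: lessThan_Suc)
    moreover have "x ! i \<notin> (!) x ` {..<i}"
      using x Suc.prems(1) by (auto simp: nth_eq_iff_index_eq)
    ultimately have "sum w (X \<inter> (!) x ` {..<Suc i}) \<le> h i"
      using h[of i] Suc.prems(1) by simp
    also have "\<dots> \<le> B" using Suc.prems(3) True by simp
    finally show ?thesis .
  qed
qed simp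

theorem ulam_dist_running_max: "ulam_dist w x q = sum w {1..n} - running_max h n"
proof (rule antisym)
  have "\<exists>X \<subseteq> {1..n}. agree x q X \<and> sum w X = running_max h n"
    using running_max_cases[of h n]
  proof
    assume "running_max h n = 0"
    then show ?thesis by (intro exI[of _ "{}"]) (simp add: agree_def)
  next
    assume "\<exists>l<n. running_max h n = h l"
    then obtain l where l: "l < n" "running_max h n = h l" by blast
    from chain_witness[OF l(1)] obtain X where "X \<subseteq> {1..n}" "agree x q X" "sum w X = h l" by blast
    with l(2) show ?thesis by auto
  qed
  then obtain X where "X \<subseteq> {1..n}" "agree x q X" "sum w X = running_max h n" by blast
  then show "ulam_dist w x q \<le> sum w {1..n} - running_max h n"
    using ulam_dist_le_agree[where X = X and w = w, OF xq wpos] by simp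
next
  obtain X where X: "X \<subseteq> {1..n}" "agree x q X" "ulam_dist w x q = sum w {1..n} - sum w X"
    by (rule ulam_dist_agree_obtains[OF xq wpos])
  have "(!) x ` {..<n} = {1..n}"
    using permsD[OF xq(1)] by (metis atLeast_upt list.set_map map_nth)
  then have "X = X \<inter> (!) x ` {..<n}" using X(1) by blast
  then have "sum w X \<le> running_max h n"
    using chain_bound[OF X(1,2) order_refl running_max_nonneg running_max_ge] by simp
  then show "sum w {1..n} - running_max h n \<le> ulam_dist w x q" using X(3) by simp
qed

end

section \<open>Bounded-loop programs\<close>

text \<open>A fragment without coin flips and unbounded loops: the meaning of a program is a
  function on states, and a polynomial time bound can be read off its syntax.\<close>

datatype loop_prog =
    LNat string nexp nexp
  | LReal string nexp rexp
  | LSeq loop_prog loop_prog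
  | LIf bexp loop_prog
  | LFor string nexp loop_prog

primrec compile :: "loop_prog \<Rightarrow> com" where
  "compile (LNat a i e) = NAssign a i e"
| "compile (LReal a i e) = RAssign a i e"
| "compile (LSeq c d) = Seq (compile c) (compile d)"
| "compile (LIf b c) = If b (compile c) SKIP"
| "compile (LFor v b c) = Seq (NAssign v (NConst 0) (NConst 0))
     (While (NLess (NAt v (NConst 0)) b)
       (Seq (compile c) (NAssign v (NConst 0) (NPlus (NAt v (NConst 0)) (NConst 1)))))"

text \<open>
  The bound of a loop is evaluated once in \<open>run\<close> but before each iteration in the compiled program;
  the two agree if the body changes neither the bound nor the counter.
\<close>

definition incr :: "string \<Rightarrow> state \<Rightarrow> state" where
  "incr v s = nset v 0 (nats s v 0 + 1) s"

primrec run :: "loop_prog \<Rightarrow> state \<Rightarrow> state" where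
  "run (LNat a i e) s = nset a (nval i s) (nval e s) s"
| "run (LReal a i e) s = rset a (nval i s) (rval e s) s"
| "run (LSeq c d) s = run d (run c s)"
| "run (LIf b c) s = (if bval b s then run c s else s)"
| "run (LFor v b c) s = ((\<lambda>s. incr v (run c s)) ^^ nval b s) (nset v 0 0 s)"

definition iter :: "string \<Rightarrow> loop_prog \<Rightarrow> state \<Rightarrow> nat \<Rightarrow> state" where
  "iter v c s k = ((\<lambda>s. incr v (run c s)) ^^ k) (nset v 0 0 s)"

text \<open>Writes are tracked per array name, whatever the index, so that frame conditions become
  set membership of strings.\<close>

primrec nat_writes :: "loop_prog \<Rightarrow> string set" where
  "nat_writes (LNat a i e) = {a}"
| "nat_writes (LReal a i e) = {}"
| "nat_writes (LSeq c d) = nat_writes c \<union> nat_writes d"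
| "nat_writes (LIf b c) = nat_writes c"
| "nat_writes (LFor v b c) = insert v (nat_writes c)"

primrec real_writes :: "loop_prog \<Rightarrow> string set" where
  "real_writes (LNat a i e) = {}"
| "real_writes (LReal a i e) = {a}"
| "real_writes (LSeq c d) = real_writes c \<union> real_writes d"
| "real_writes (LIf b c) = real_writes c"
| "real_writes (LFor v b c) = real_writes c"

declare run.simps(5) [simp del]

lemma nats_nset [simp]: "nats (nset a i v s) b j = (if b = a \<and> j = i then v else nats s b j)"
  and reals_nset [simp]: "reals (nset a i v s) = reals s"
  and reals_rset [simp]: "reals (rset a i x s) b j = (if b = a \<and> j = i then x else reals s b j)"
  and nats_rset [simp]: "nats (rset a i x s) = nats s"
  unfolding nset_def rset_def by simp_all

lemma nats_nset_other: "b \<noteq> a \<Longrightarrow> nats (nset a i v s) b = nats s b"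
  and reals_rset_other: "b \<noteq> a \<Longrightarrow> reals (rset a i x s) b = reals s b"
  unfolding nset_def rset_def by simp_all

lemma nats_run_other: "a \<notin> nat_writes c \<Longrightarrow> nats (run c s) a = nats s a"
proof (induction c arbitrary: s)
  case (LFor v b c)
  have "nats (((\<lambda>s. incr v (run c s)) ^^ k) (nset v 0 0 s)) a = nats s a" for k
    by (induction k) (use LFor in \<open>auto simp: incr_def nats_nset_other\<close>)
  then show ?case by (simp add: run.simps(5))
qed (auto simp: nats_nset_other)

lemma reals_run_other: "a \<notin> real_writes c \<Longrightarrow> reals (run c s) a = reals s a"
proof (induction c arbitrary: s)
  case (LFor v b c)
  have "reals (((\<lambda>s. incr v (run c s)) ^^ k) (nset v 0 0 s)) a = reals s a" for k
    by (induction k) (use LFor in \<open>auto simp: incr_def\<close>)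
  then show ?case by (simp add: run.simps(5))
qed (auto simp: reals_rset_other)

lemma run_LFor: "run (LFor v b c) s = iter v c s (nval b s)"
  unfolding iter_def by (simp add: run.simps(5))

lemma iter_0 [simp]: "iter v c s 0 = nset v 0 0 s"
  and iter_Suc [simp]: "iter v c s (Suc k) = incr v (run c (iter v c s k))"
  unfolding iter_def by simp_all

lemma nats_incr [simp]: "nats (incr v s) a j = (if a = v \<and> j = 0 then Suc (nats s v 0) else nats s a j)"
  and reals_incr [simp]: "reals (incr v s) = reals s"
  unfolding incr_def by simp_all

lemma nats_iter_other: "a \<notin> nat_writes c \<Longrightarrow> a \<noteq> v \<Longrightarrow> nats (iter v c s k) a = nats s a"
  by (induction k) (auto simp: incr_def nats_nset_other nats_run_other)

lemma reals_iter_other: "a \<notin> real_writes c \<Longrightarrow> reals (iter v c s k) a = reals s a"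
  by (induction k) (auto simp: reals_run_other)

lemma iter_counter: "v \<notin> nat_writes c \<Longrightarrow> nats (iter v c s k) v 0 = k"
  by (induction k) (auto simp: nats_run_other)

primrec bounds :: "loop_prog \<Rightarrow> nexp set" where
  "bounds (LNat a i e) = {}"
| "bounds (LReal a i e) = {}"
| "bounds (LSeq c d) = bounds c \<union> bounds d"
| "bounds (LIf b c) = bounds c"
| "bounds (LFor v b c) = insert b (bounds c)"

primrec fresh_counters :: "loop_prog \<Rightarrow> bool" where
  "fresh_counters (LNat a i e) \<longleftrightarrow> True"
| "fresh_counters (LReal a i e) \<longleftrightarrow> True"
| "fresh_counters (LSeq c d) \<longleftrightarrow> fresh_counters c \<and> fresh_counters d"
| "fresh_counters (LIf b c) \<longleftrightarrow> fresh_counters c"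
| "fresh_counters (LFor v b c) \<longleftrightarrow> v \<notin> nat_writes c \<and> fresh_counters c"

primrec nat_reads :: "nexp \<Rightarrow> string set" where
  "nat_reads (NConst k) = {}"
| "nat_reads (NAt a i) = insert a (nat_reads i)"
| "nat_reads (NPlus e f) = nat_reads e \<union> nat_reads f"
| "nat_reads (NMinus e f) = nat_reads e \<union> nat_reads f"

lemma nval_cong: "(\<And>a. a \<in> nat_reads e \<Longrightarrow> nats s a = nats s' a) \<Longrightarrow> nval e s = nval e s'"
  by (induction e) auto

text \<open>The variable of the polynomial stands for a common bound on all loop bounds. Each pass
  adds 4 steps: unfolding the \<open>While\<close>, the increment, and leaving two sequential
  compositions. The remaining 3 are the counter initialisation, its composition and the final
  test.\<close>

primrec time :: "loop_prog \<Rightarrow> nat poly" where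
  "time (LNat a i e) = 1"
| "time (LReal a i e) = 1"
| "time (LSeq c d) = time c + 1 + time d"
| "time (LIf b c) = 1 + time c"
| "time (LFor v b c) = 3 + [:0, 1:] * (time c + 4)"

section \<open>Deterministic execution in the probabilistic small-step semantics\<close>

definition det_step :: "((com \<times> state) \<times> (com \<times> state)) set" where
  "det_step = {(x, y). fst x \<noteq> SKIP \<and> step x = return_pmf y}"

lemma det_step_Seq:
  assumes "((c, s), (c', s')) \<in> det_step"
  shows "((Seq c d, s), (Seq c' d, s')) \<in> det_step"
  using assms unfolding det_step_def by simp

lemma det_steps_Seq:
  "((c, s), (c', s')) \<in> det_step ^^ t \<Longrightarrow> ((Seq c d, s), (Seq c' d, s')) \<in> det_step ^^ t"
proof (induction t arbitrary: c s)
  case (Suc t)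
  from relpow_Suc_D2[OF Suc.prems] obtain c1 s1 where
    "((c, s), (c1, s1)) \<in> det_step" "((c1, s1), (c', s')) \<in> det_step ^^ t"
    by auto
  with Suc.IH det_step_Seq show ?case by (meson relpow_Suc_I2)
qed simp

definition exec :: "com \<Rightarrow> state \<Rightarrow> state \<Rightarrow> nat \<Rightarrow> bool" where
  "exec c s s' t \<longleftrightarrow> ((c, s), (SKIP, s')) \<in> det_step ^^ t"

lemma exec_step:
  assumes "((c, s), (c', s')) \<in> det_step" "exec c' s' s'' t"
  shows "exec c s s'' (Suc t)"
  using assms unfolding exec_def by (meson relpow_Suc_I2)

lemma exec_SKIP: "exec SKIP s s 0"
  unfolding exec_def by simp

lemma exec_Seq:
  assumes "exec c s s' t" "exec d s' s'' u"
  shows "exec (Seq c d) s s'' (t + 1 + u)"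
proof -
  have "((Seq c d, s), (Seq SKIP d, s')) \<in> det_step ^^ t"
    using assms(1) unfolding exec_def by (rule det_steps_Seq)
  moreover have "((Seq SKIP d, s'), (d, s')) \<in> det_step" unfolding det_step_def by simp
  then have "exec (Seq SKIP d) s' s'' (Suc u)" using assms(2) by (rule exec_step)
  ultimately have "((Seq c d, s), (SKIP, s'')) \<in> det_step ^^ (t + Suc u)"
    unfolding exec_def by (rule relpow_trans)
  then show ?thesis unfolding exec_def by simp
qed

lemma exec_NAssign: "exec (NAssign a i e) s (nset a (nval i s) (nval e s) s) 1"
  unfolding One_nat_def by (rule exec_step[OF _ exec_SKIP]) (simp add: det_step_def)

lemma exec_RAssign: "exec (RAssign a i e) s (rset a (nval i s) (rval e s) s) 1"
  unfolding One_nat_def by (rule exec_step[OF _ exec_SKIP]) (simp add: det_step_def)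

lemma exec_If:
  assumes "exec (if bval b s then c else d) s s' t"
  shows "exec (If b c d) s s' (Suc t)"
  by (rule exec_step[OF _ assms]) (simp add: det_step_def)

lemma exec_While_True:
  assumes "bval b s" "exec (Seq c (While b c)) s s' t"
  shows "exec (While b c) s s' (Suc t)"
  by (rule exec_step[OF _ assms(2)]) (simp add: det_step_def assms(1))

lemma exec_While_False: "\<not> bval b s \<Longrightarrow> exec (While b c) s s 1"
  unfolding One_nat_def by (rule exec_step[OF _ exec_SKIP]) (simp add: det_step_def)

text \<open>\<open>K\<close> holds the arrays read by loop bounds. As the program never writes them,
  every bound keeps its initial value throughout, so \<open>N\<close> bounds the number of passes of
  each loop at any time.\<close>

lemma exec_compile:
  assumes "fresh_counters c" "\<And>b. b \<in> bounds c \<Longrightarrow> nat_reads b \<subseteq> K" "K \<inter> nat_writes c = {}"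
    and "\<And>b. b \<in> bounds c \<Longrightarrow> nval b s \<le> N"
  shows "\<exists>t \<le> poly (time c) N. exec (compile c) s (run c s) t"
  using assms
proof (induction c arbitrary: s)
  case (LNat a i e)
  then show ?case using exec_NAssign by auto
next
  case (LReal a i e)
  then show ?case using exec_RAssign by auto
next
  case (LSeq c d)
  have "\<exists>t \<le> poly (time c) N. exec (compile c) s (run c s) t"
    using LSeq.prems by (intro LSeq.IH(1)) auto
  then obtain t where t: "t \<le> poly (time c) N" "exec (compile c) s (run c s) t"
    by blast
  have "nval b (run c s) = nval b s" if "b \<in> bounds d" for b
    using that LSeq.prems(2)[of b] LSeq.prems(3) by (intro nval_cong nats_run_other) auto
  then have "\<exists>t \<le> poly (time d) N. exec (compile d) (run c s) (run d (run c s)) t"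
    using LSeq.prems by (intro LSeq.IH(2)) auto
  then obtain u where u: "u \<le> poly (time d) N" "exec (compile d) (run c s) (run d (run c s)) u"
    by blast
  show ?case using exec_Seq[OF t(2) u(2)] t(1) u(1)
    by (intro exI[of _ "t + 1 + u"]) simp
next
  case (LIf b c)
  have "\<exists>t \<le> poly (time c) N. exec (compile c) s (run c s) t"
    using LIf.prems by (intro LIf.IH) auto
  then obtain t where t: "t \<le> poly (time c) N" "exec (compile c) s (run c s) t"
    by blast
  show ?case
  proof (cases "bval b s")
    case True
    then show ?thesis using exec_If[of b s "compile c" SKIP "run c s" t] t
      by (intro exI[of _ "Suc t"]) simp
  next
    case False
    then show ?thesis using exec_If[of b s "compile c" SKIP s 0] exec_SKIP
      by (intro exI[of _ "Suc 0"]) simp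
  qed
next
  case (LFor v b c)
  define W where "W = While (NLess (NAt v (NConst 0)) b)
       (Seq (compile c) (NAssign v (NConst 0) (NPlus (NAt v (NConst 0)) (NConst 1))))"
  have v: "v \<notin> nat_writes c" using LFor.prems by simp
  have bnd: "nval b' (iter v c s k) = nval b' s" if "b' \<in> insert b (bounds c)" for b' k
    using that LFor.prems(2)[of b'] LFor.prems(3) by (intro nval_cong nats_iter_other) auto
  have body: "\<exists>t \<le> poly (time c) N. exec (compile c) (iter v c s k) (run c (iter v c s k)) t" for k
    using LFor.prems bnd by (intro LFor.IH) auto
  \<comment> \<open>Induction on the number \<open>j\<close> of passes still to come.\<close>
  have loop: "\<exists>t \<le> j * (poly (time c) N + 4) + 1. exec W (iter v c s k) (iter v c s (nval b s)) t"
    if "k + j = nval b s" for j k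
    using that
  proof (induction j arbitrary: k)
    case 0
    then show ?case
      using exec_While_False[of "NLess (NAt v (NConst 0)) b" "iter v c s k"] iter_counter[OF v] bnd[of b]
      unfolding W_def by (intro exI[of _ 1]) auto
  next
    case (Suc j)
    then obtain t where t: "t \<le> j * (poly (time c) N + 4) + 1"
        "exec W (iter v c s (Suc k)) (iter v c s (nval b s)) t"
      by (metis add_Suc_shift)
    from body[of k] obtain u where u: "u \<le> poly (time c) N"
        "exec (compile c) (iter v c s k) (run c (iter v c s k)) u" by blast
    have "bval (NLess (NAt v (NConst 0)) b) (iter v c s k)"
      using Suc.prems iter_counter[OF v] bnd[of b] by simp
    moreover have "exec (NAssign v (NConst 0) (NPlus (NAt v (NConst 0)) (NConst 1)))
        (run c (iter v c s k)) (iter v c s (Suc k)) 1"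
      using exec_NAssign[of v "NConst 0" "NPlus (NAt v (NConst 0)) (NConst 1)" "run c (iter v c s k)"]
      by (simp add: incr_def)
    ultimately have "exec W (iter v c s k) (iter v c s (nval b s)) (Suc (u + 1 + 1 + 1 + t))"
      using u(2) t(2) unfolding W_def by (intro exec_While_True exec_Seq)
    then show ?case using t(1) u(1) by (intro exI[of _ "Suc (u + 1 + 1 + 1 + t)"]) simp
  qed
  from loop[of 0 "nval b s"] obtain t where t: "t \<le> nval b s * (poly (time c) N + 4) + 1"
      "exec W (nset v 0 0 s) (iter v c s (nval b s)) t" by auto
  have "exec (NAssign v (NConst 0) (NConst 0)) s (nset v 0 0 s) 1"
    using exec_NAssign[of v "NConst 0" "NConst 0" s] by simp
  from exec_Seq[OF this t(2)]
  have "exec (compile (LFor v b c)) s (run (LFor v b c) s) (1 + 1 + t)"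
    unfolding run_LFor by (simp add: W_def)
  moreover have "nval b s * (poly (time c) N + 4) \<le> N * (poly (time c) N + 4)"
    using LFor.prems(4)[of b] by (intro mult_right_mono) auto
  then have "t \<le> N * (poly (time c) N + 4) + 1" using t(1) by linarith
  then have "1 + 1 + t \<le> poly (time (LFor v b c)) N" by simp
  ultimately show ?case by blast
qed

text \<open>A finished program idles in \<open>SKIP\<close>, so any larger number of steps yields
  the same point mass.\<close>

lemma exec_steps:
  "exec c s s' t \<Longrightarrow> t \<le> T \<Longrightarrow> steps T (c, s) = return_pmf (SKIP, s')"
proof (induction t arbitrary: c s T)
  case 0
  have "steps T (SKIP, s) = return_pmf (SKIP, s)" for T
    by (induction T) (auto simp: bind_return_pmf)
  then show ?case using 0 unfolding exec_def by simp
next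
  case (Suc t)
  from relpow_Suc_D2[OF Suc.prems(1)[unfolded exec_def]] obtain c1 s1 where
    1: "((c, s), (c1, s1)) \<in> det_step" "exec c1 s1 s' t"
    unfolding exec_def by auto
  from Suc.prems(2) obtain T' where T: "T = Suc T'" "t \<le> T'" by (cases T) auto
  show ?case using Suc.IH[OF 1(2) T(2)] 1(1) unfolding T(1) det_step_def
    by (simp add: bind_return_pmf)
qed

section \<open>The positions and the majority tournament in memory\<close>

abbreviation V :: "string \<Rightarrow> nexp" where
  "V x \<equiv> NAt x (NConst 0)"

abbreviation Or :: "bexp \<Rightarrow> bexp \<Rightarrow> bexp" where
  "Or b c \<equiv> Not (And (Not b) (Not c))"

text \<open>
  There is no multiplication of naturals, so entry \<open>(i, k)\<close> of a matrix with \<open>n\<close> columns is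
  addressed through the table \<open>M\<close> of multiples of \<open>n\<close>. The row or column of an
  element \<open>e\<close> has index \<open>e - 1\<close>, whereas the vectors \<open>w\<close> and \<open>r\<close> are indexed by \<open>e\<close> itself.
\<close>

abbreviation cell :: "nexp \<Rightarrow> nexp \<Rightarrow> nexp" where
  "cell i k \<equiv> NPlus (NAt ''M'' i) k"

text \<open>Row-major addressing is injective: division and remainder by \<open>n\<close> recover
  row and column.\<close>

lemma cell_eq_iff:
  fixes n :: nat
  assumes "k < n" "k' < n"
  shows "i * n + k = i' * n + k' \<longleftrightarrow> i = i' \<and> k = k'"
proof
  assume "i * n + k = i' * n + k'"
  then have "(i * n + k) div n = (i' * n + k') div n" "(i * n + k) mod n = (i' * n + k') mod n"
    by simp_all
  then show "i = i' \<and> k = k'" using assms by simp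
qed simp

definition multiples_step :: loop_prog where
  "multiples_step = LNat ''M'' (NPlus (V ''k'') (NConst 1)) (NPlus (NAt ''M'' (V ''k'')) (V ''n''))"

text \<open>The range covers the rows of the majority matrix, those of the inputs, and row
  \<open>m\<close>, where the constructed candidate will be stored.\<close>

definition multiples_prog :: loop_prog where
  "multiples_prog = LFor ''k'' (NPlus (V ''n'') (V ''m'')) multiples_step"

lemma iter_multiples_step:
  assumes "nats s ''M'' 0 = 0" "k' \<le> k"
  shows "nats (iter ''k'' multiples_step s k) ''M'' k' = k' * nats s ''n'' 0"
  using assms(2)
proof (induction k arbitrary: k')
  case (Suc k)
  then show ?case
    by (cases "k' = Suc k") (auto simp: multiples_step_def nats_iter_other iter_counter)
qed (simp add: assms(1))

text \<open>Row \<open>j\<close> of \<open>pos\<close> becomes the inverse of the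
  \<open>j\<close>-th input, so that precedence costs one comparison.\<close>

definition pos_step :: loop_prog where
  "pos_step = LNat ''pos'' (cell (V ''j'') (NMinus (NAt ''P'' (cell (V ''j'') (V ''i''))) (NConst 1))) (V ''i'')"

definition pos_row :: loop_prog where
  "pos_row = LFor ''i'' (V ''n'') pos_step"

definition pos_prog :: loop_prog where
  "pos_prog = LFor ''j'' (V ''m'') pos_row"

text \<open>The input is taken from the scalar \<open>j\<close>, which lets the majority count and
  the later chain computation share this test.\<close>

definition precedes :: "nexp \<Rightarrow> nexp \<Rightarrow> bexp" where
  "precedes a b = NLess (NAt ''pos'' (cell (V ''j'') a)) (NAt ''pos'' (cell (V ''j'') b))"

definition count_step :: loop_prog where
  "count_step = LIf (precedes (V ''a'') (V ''b'')) (LNat ''C'' (NConst 0) (NPlus (V ''C'') (NConst 2)))"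

text \<open>The counter \<open>C\<close> holds \<open>2 * cnt ps a b + of_bool (a < b)\<close> from the definition of \<open>maj\<close>.\<close>

definition maj_step :: loop_prog where
  "maj_step =
     LSeq (LNat ''C'' (NConst 0) (NConst 0))
    (LSeq (LIf (NLess (V ''a'') (V ''b'')) (LNat ''C'' (NConst 0) (NConst 1)))
    (LSeq (LFor ''j'' (V ''m'') count_step)
    (LSeq (LNat ''E'' (cell (V ''a'') (V ''b'')) (NConst 0))
          (LIf (NLess (V ''m'') (V ''C'')) (LNat ''E'' (cell (V ''a'') (V ''b'')) (NConst 1))))))"

definition maj_row :: loop_prog where
  "maj_row = LFor ''b'' (V ''n'') maj_step"

definition maj_prog :: loop_prog where
  "maj_prog = LFor ''a'' (V ''n'') maj_row"

locale median_instance =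
  fixes n :: nat and ps :: "nat list list" and w :: "nat \<Rightarrow> real"
  assumes ps: "ps \<noteq> []" "set ps \<subseteq> perms n" and wpos: "\<And>e. e \<in> {1..n} \<Longrightarrow> w e > 0"
begin

text \<open>The memory contents that stay fixed once \<open>multiples_prog\<close> has run: no later
  phase writes these arrays.\<close>

definition base :: "state \<Rightarrow> bool" where
  "base s \<longleftrightarrow> nats s ''n'' 0 = n \<and> nats s ''m'' 0 = length ps \<and>
     (\<forall>k \<le> n + length ps. nats s ''M'' k = k * n) \<and> (\<forall>e\<in>{1..n}. reals s ''w'' e = w e)"

lemma baseD [simp]:
  assumes "base s"
  shows "nats s ''n'' 0 = n" "nats s ''m'' 0 = length ps"
    "k \<le> n + length ps \<Longrightarrow> nats s ''M'' k = k * n"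
    "e \<le> n \<Longrightarrow> 0 < e \<Longrightarrow> reals s ''w'' e = w e"
  using assms unfolding base_def by auto

lemma base_cong:
  assumes "nats s' ''n'' = nats s ''n''" "nats s' ''m'' = nats s ''m''" "nats s' ''M'' = nats s ''M''"
    "reals s' ''w'' = reals s ''w''"
  shows "base s' \<longleftrightarrow> base s"
  using assms unfolding base_def by simp

lemma base_run:
  assumes "{''n'', ''m'', ''M''} \<inter> nat_writes c = {}" "''w'' \<notin> real_writes c"
  shows "base (run c s) \<longleftrightarrow> base s"
  using assms by (intro base_cong) (auto simp: nats_run_other reals_run_other)

lemma base_iter:
  assumes "{''n'', ''m'', ''M''} \<inter> insert v (nat_writes c) = {}" "''w'' \<notin> real_writes c"
  shows "base (iter v c s k) \<longleftrightarrow> base s"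
  using assms by (intro base_cong) (auto simp: nats_iter_other reals_iter_other)

lemma base_nset: "a \<notin> {''n'', ''m'', ''M''} \<Longrightarrow> base (nset a i v s) \<longleftrightarrow> base s"
  by (intro base_cong) (auto simp: nats_nset_other)

lemma base_rset: "a \<noteq> ''w'' \<Longrightarrow> base (rset a i v s) \<longleftrightarrow> base s"
  by (intro base_cong) (auto simp: reals_rset_other)

lemmas frame = nats_run_other reals_run_other nats_iter_other reals_iter_other
  base_run base_iter base_nset base_rset iter_counter

text \<open>The list is a parameter because the constructed permutation later joins the inputs as
  one more row.\<close>

definition rows :: "nat list list \<Rightarrow> (nat \<Rightarrow> nat) \<Rightarrow> bool" where
  "rows xs f \<longleftrightarrow> (\<forall>c<length xs. \<forall>i<n. f (c * n + i) = xs ! c ! i)"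

lemma rowsD: "rows xs f \<Longrightarrow> c < length xs \<Longrightarrow> i < n \<Longrightarrow> f (c * n + i) = xs ! c ! i"
  unfolding rows_def by blast

lemma nth_ps:
  assumes "j < length ps"
  shows "ps ! j \<in> perms n" "distinct (ps ! j)" "set (ps ! j) = {1..n}" "length (ps ! j) = n"
  using permsD[of "ps ! j" n] nth_mem[OF assms] ps(2) by auto

lemma entry_range:
  assumes "j < length ps" "i < n"
  shows "0 < ps ! j ! i" "ps ! j ! i \<le> n"
  using nth_ps[OF assms(1)] assms(2) nth_mem[of i "ps ! j"] by auto

lemma entry_eq_iff:
  assumes "j < length ps" "i < n" "i' < n"
  shows "ps ! j ! i - 1 = ps ! j ! i' - 1 \<longleftrightarrow> i = i'"
  using nth_eq_iff_index_eq[of "ps ! j" i i'] nth_ps[OF assms(1)] assms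
    entry_range[OF assms(1,2)] entry_range[OF assms(1,3)] by auto

lemma iter_pos_step:
  assumes "base s" "rows ps (nats s ''P'')" "nats s ''j'' 0 = j" "j < length ps" "l \<le> n"
    and "j' < length ps" "i' < n"
  shows "nats (iter ''i'' pos_step s l) ''pos'' (j' * n + (ps ! j' ! i' - 1)) =
    (if j' = j \<and> i' < l then i' else nats s ''pos'' (j' * n + (ps ! j' ! i' - 1)))"
  using assms(5)
proof (induction l)
  case (Suc l)
  let ?s = "iter ''i'' pos_step s l"
  have "base ?s" using assms(1) by (simp add: frame pos_step_def)
  moreover have "rows ps (nats ?s ''P'')" using assms(2) by (simp add: frame pos_step_def)
  moreover have "nats ?s ''i'' 0 = l" by (simp add: frame pos_step_def)
  moreover have "nats ?s ''j'' 0 = j" using assms(3) by (simp add: frame pos_step_def)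
  \<comment> \<open>No cell is written twice: entries within one input are distinct, and they are at
    least 1, so the truncated subtraction is exact.\<close>
  moreover have "j' * n + (ps ! j' ! i' - 1) = j * n + (ps ! j ! l - 1) \<longleftrightarrow> j' = j \<and> i' = l"
    using cell_eq_iff[of "ps ! j' ! i' - 1" n "ps ! j ! l - 1" j' j]
      entry_range[OF assms(6,7)] entry_range[OF assms(4), of l] entry_eq_iff[of j i' l] assms Suc.prems
    by auto
  ultimately show ?case
    using Suc assms(4) rowsD[of ps "nats ?s ''P''" j l] by (auto simp: pos_step_def)
qed (use assms in simp)

lemma iter_pos_row:
  assumes "base s" "rows ps (nats s ''P'')" "k \<le> length ps" "j' < length ps" "i' < n"
  shows "nats (iter ''j'' pos_row s k) ''pos'' (j' * n + (ps ! j' ! i' - 1)) =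
    (if j' < k then i' else nats s ''pos'' (j' * n + (ps ! j' ! i' - 1)))"
  using assms(3)
proof (induction k)
  case (Suc k)
  let ?s = "iter ''j'' pos_row s k"
  have "base ?s" using assms(1) by (simp add: frame pos_row_def pos_step_def)
  moreover have "rows ps (nats ?s ''P'')" using assms(2) by (simp add: frame pos_row_def pos_step_def)
  moreover have "nats ?s ''j'' 0 = k" by (simp add: frame pos_row_def pos_step_def)
  ultimately have "nats (run pos_row ?s) ''pos'' (j' * n + (ps ! j' ! i' - 1)) =
      (if j' = k \<and> i' < n then i' else nats ?s ''pos'' (j' * n + (ps ! j' ! i' - 1)))"
    using iter_pos_step[of ?s k n j' i'] Suc.prems assms(4,5) by (simp add: pos_row_def run_LFor)
  then show ?case using Suc assms by auto
qed (use assms in simp)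

text \<open>The table is described only through comparisons, the form in which
  \<open>precedes\<close> consults it.\<close>

definition positions :: "(nat \<Rightarrow> nat) \<Rightarrow> bool" where
  "positions f \<longleftrightarrow> (\<forall>j<length ps. \<forall>a\<in>{1..n}. \<forall>b\<in>{1..n}.
     f (j * n + (a - 1)) < f (j * n + (b - 1)) \<longleftrightarrow> bef (ps ! j) a b)"

lemma positionsD: "positions f \<Longrightarrow> j < length ps \<Longrightarrow> a \<in> {1..n} \<Longrightarrow> b \<in> {1..n} \<Longrightarrow>
  f (j * n + (a - 1)) < f (j * n + (b - 1)) \<longleftrightarrow> bef (ps ! j) a b"
  unfolding positions_def by blast

lemma positions_pos_prog:
  assumes "base s" "rows ps (nats s ''P'')"
  shows "positions (nats (run pos_prog s) ''pos'')"
  unfolding positions_def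
proof (intro allI impI ballI)
  fix j a b assume j: "j < length ps" and "a \<in> {1..n}" "b \<in> {1..n}"
  then obtain i k where ik: "i < n" "k < n" "a = ps ! j ! i" "b = ps ! j ! k"
    using nth_ps[OF j] by (metis in_set_conv_nth)
  have "nats (run pos_prog s) ''pos'' (j * n + (ps ! j ! l - 1)) = l" if "l < n" for l
    using iter_pos_row[OF assms order_refl j that] j assms(1) by (simp add: pos_prog_def run_LFor)
  then show "nats (run pos_prog s) ''pos'' (j * n + (a - 1)) < nats (run pos_prog s) ''pos'' (j * n + (b - 1))
      \<longleftrightarrow> bef (ps ! j) a b"
    using ik bef_nth[of "ps ! j" i k] nth_ps[OF j] by simp
qed

lemma iter_count_step:
  assumes "base s" "positions (nats s ''pos'')" "nats s ''a'' 0 = a" "nats s ''b'' 0 = b" "a < n" "b < n" "k \<le> length ps"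
  shows "nats (iter ''j'' count_step s k) ''C'' 0 =
    nats s ''C'' 0 + 2 * (\<Sum>j<k. of_bool (bef (ps ! j) (Suc a) (Suc b)))"
  using assms(7)
proof (induction k)
  case (Suc k)
  let ?s = "iter ''j'' count_step s k"
  have "base ?s" using assms(1) by (simp add: frame count_step_def)
  moreover have "positions (nats ?s ''pos'')" using assms(2) by (simp add: frame count_step_def)
  moreover have "nats ?s ''j'' 0 = k" by (simp add: frame count_step_def)
  moreover have "nats ?s ''a'' 0 = a" "nats ?s ''b'' 0 = b"
    using assms(3,4) by (simp_all add: frame count_step_def)
  ultimately show ?case
    using Suc positionsD[of "nats ?s ''pos''" k "Suc a" "Suc b"] assms(5,6) by (simp add: count_step_def precedes_def)
qed simp

lemma run_maj_step:
  assumes "base s" "positions (nats s ''pos'')" "nats s ''a'' 0 = a" "nats s ''b'' 0 = b" "a < n" "b < n"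
  shows "nats (run maj_step s) ''E'' =
    (nats s ''E'')(a * n + b := of_bool (maj ps (Suc a) (Suc b)))"
proof -
  define s1 where "s1 = run (LIf (NLess (V ''a'') (V ''b'')) (LNat ''C'' (NConst 0) (NConst 1)))
    (run (LNat ''C'' (NConst 0) (NConst 0)) s)"
  have s1: "base s1" "positions (nats s1 ''pos'')" "nats s1 ''a'' 0 = a" "nats s1 ''b'' 0 = b"
    "nats s1 ''C'' 0 = of_bool (a < b)" "nats s1 ''E'' = nats s ''E''"
    using assms unfolding s1_def by (auto simp: frame nats_nset_other)
  define s2 where "s2 = iter ''j'' count_step s1 (length ps)"
  have s2: "base s2" "nats s2 ''a'' 0 = a" "nats s2 ''b'' 0 = b" "nats s2 ''E'' = nats s ''E''"
    using s1 unfolding s2_def by (simp_all add: frame count_step_def)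
  have c: "length ps < nats s2 ''C'' 0 \<longleftrightarrow> maj ps (Suc a) (Suc b)"
    using iter_count_step[OF s1(1-4) assms(5,6) order_refl] s1(5)
    unfolding maj_def cnt_def s2_def by (simp add: add.commute)
  have "run maj_step s = run (LSeq (LNat ''E'' (cell (V ''a'') (V ''b'')) (NConst 0))
          (LIf (NLess (V ''m'') (V ''C'')) (LNat ''E'' (cell (V ''a'') (V ''b'')) (NConst 1)))) s2"
    unfolding maj_step_def s2_def run.simps(3) run_LFor s1_def[symmetric] using s1(1) by simp
  then show ?thesis
    using s2 c assms(5,6) by (auto simp: fun_eq_iff)
qed

lemma iter_maj_step:
  assumes "base s" "positions (nats s ''pos'')" "nats s ''a'' 0 = a" "a < n" "k \<le> n" "a' < n" "b' < n"
  shows "nats (iter ''b'' maj_step s k) ''E'' (a' * n + b') =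
    (if a' = a \<and> b' < k then of_bool (maj ps (Suc a') (Suc b')) else nats s ''E'' (a' * n + b'))"
  using assms(5)
proof (induction k)
  case (Suc k)
  let ?s = "iter ''b'' maj_step s k"
  have "base ?s" using assms(1) by (simp add: frame maj_step_def count_step_def)
  moreover have "positions (nats ?s ''pos'')" using assms(2) by (simp add: frame maj_step_def count_step_def)
  moreover have "nats ?s ''b'' 0 = k" by (simp add: frame maj_step_def count_step_def)
  moreover have "nats ?s ''a'' 0 = a" using assms(3) by (simp add: frame maj_step_def count_step_def)
  ultimately have "nats (run maj_step ?s) ''E'' =
      (nats ?s ''E'')(a * n + k := of_bool (maj ps (Suc a) (Suc k)))"
    using run_maj_step[of ?s a k] Suc.prems assms(4) by simp
  then show ?case
    using Suc cell_eq_iff[of b' n k a' a] assms(7) by auto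
qed simp

lemma iter_maj_row:
  assumes "base s" "positions (nats s ''pos'')" "k \<le> n" "a' < n" "b' < n"
  shows "nats (iter ''a'' maj_row s k) ''E'' (a' * n + b') =
    (if a' < k then of_bool (maj ps (Suc a') (Suc b')) else nats s ''E'' (a' * n + b'))"
  using assms(3)
proof (induction k)
  case (Suc k)
  let ?s = "iter ''a'' maj_row s k"
  have "base ?s" using assms(1) by (simp add: frame maj_row_def maj_step_def count_step_def)
  moreover have "positions (nats ?s ''pos'')"
    using assms(2) by (simp add: frame maj_row_def maj_step_def count_step_def)
  moreover have "nats ?s ''a'' 0 = k" by (simp add: frame maj_row_def maj_step_def count_step_def)
  ultimately have "nats (run maj_row ?s) ''E'' (a' * n + b') =
      (if a' = k \<and> b' < n then of_bool (maj ps (Suc a') (Suc b')) else nats ?s ''E'' (a' * n + b'))"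
    using iter_maj_step[of ?s k n a' b'] Suc.prems assms(4,5) by (simp add: maj_row_def run_LFor)
  then show ?case using Suc assms by auto
qed simp

definition majorities :: "(nat \<Rightarrow> nat) \<Rightarrow> bool" where
  "majorities f \<longleftrightarrow> (\<forall>a<n. \<forall>b<n. f (a * n + b) = of_bool (maj ps (Suc a) (Suc b)))"

lemma majoritiesD: "majorities f \<Longrightarrow> a < n \<Longrightarrow> b < n \<Longrightarrow>
  f (a * n + b) = of_bool (maj ps (Suc a) (Suc b))"
  unfolding majorities_def by blast

lemma majorities_maj_prog:
  assumes "base s" "positions (nats s ''pos'')"
  shows "majorities (nats (run maj_prog s) ''E'')"
  unfolding majorities_def
  using iter_maj_row[OF assms order_refl] assms(1) by (simp add: maj_prog_def run_LFor)

end

section \<open>Charging the cyclic triples\<close>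

definition has_edge :: "nexp \<Rightarrow> nexp \<Rightarrow> bexp" where
  "has_edge a b = NLess (NConst 0) (NAt ''E'' (cell a b))"

abbreviation residual :: "nexp \<Rightarrow> rexp" where
  "residual a \<equiv> RAt ''r'' (NPlus a (NConst 1))"

abbreviation RV :: "string \<Rightarrow> rexp" where
  "RV x \<equiv> RAt x (NConst 0)"

definition lower_to :: "string \<Rightarrow> loop_prog" where
  "lower_to x = LIf (RLess (residual (V x)) (RV ''d'')) (LReal ''d'' (NConst 0) (residual (V x)))"

definition charge :: "string \<Rightarrow> loop_prog" where
  "charge x = LReal ''r'' (NPlus (V x) (NConst 1)) (RMinus (residual (V x)) (RV ''d''))"

definition reduce_step :: loop_prog where
  "reduce_step = LIf (And (And (has_edge (V ''a'') (V ''b'')) (has_edge (V ''b'') (V ''c''))) (has_edge (V ''c'') (V ''a'')))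
    (LSeq (LReal ''d'' (NConst 0) (residual (V ''a'')))
    (LSeq (lower_to ''b'') (LSeq (lower_to ''c'')
    (LSeq (charge ''a'') (LSeq (charge ''b'') (charge ''c''))))))"

text \<open>
  One pass over all triples suffices: a charged triple contains an element of residual weight 0, and
  residual weights never increase.
\<close>

definition reduce_row :: loop_prog where
  "reduce_row = LFor ''c'' (V ''n'') reduce_step"

definition reduce_rows :: loop_prog where
  "reduce_rows = LFor ''b'' (V ''n'') reduce_row"

definition init_step :: loop_prog where
  "init_step = LReal ''r'' (NPlus (V ''a'') (NConst 1)) (RAt ''w'' (NPlus (V ''a'') (NConst 1)))"

definition reduce_prog :: loop_prog where
  "reduce_prog = LSeq (LFor ''a'' (V ''n'') init_step) (LFor ''a'' (V ''n'') reduce_rows)"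

lemma sum_mult_of_bool:
  fixes f :: "nat \<Rightarrow> real"
  assumes "T \<subseteq> A" "finite A"
  shows "(\<Sum>e\<in>A. d * of_bool (e \<in> T) * f e) = d * sum f T"
proof -
  have "(\<Sum>e\<in>A. d * of_bool (e \<in> T) * f e) = (\<Sum>e\<in>T. d * f e)"
    using assms by (intro sum.mono_neutral_cong_right) auto
  then show ?thesis by (simp add: sum_distrib_left)
qed

text \<open>Charging raises the left sum by \<open>3 * d\<close> and the right sum by
  \<open>d * (\<phi> a + \<phi> b + \<phi> c)\<close>, which is at least as much. As
  \<open>d\<close> is the minimum of the three residuals, none becomes negative.\<close>

lemma partial_cover_charge:
  assumes r: "partial_cover ps n w r" and abc: "a \<in> {1..n}" "b \<in> {1..n}" "c \<in> {1..n}"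
    and d: "d = min (r a) (min (r b) (r c))" and cyc: "cyclic ps a b c"
    and ne: "a \<noteq> b" "b \<noteq> c" "c \<noteq> a"
  shows "partial_cover ps n w (r(a := r a - d, b := r b - d, c := r c - d))"
proof -
  let ?r = "r(a := r a - d, b := r b - d, c := r c - d)"
  let ?T = "{a, b, c}"
  have r': "?r e = r e - d * of_bool (e \<in> ?T)" for e using ne by auto
  have T: "?T \<subseteq> {1..n}" using abc by simp
  have r0: "0 \<le> r e" "r e \<le> w e" if "e \<in> {1..n}" for e
    using r that unfolding partial_cover_def by auto
  then have "0 \<le> d" using abc d by simp
  have "0 \<le> ?r e \<and> ?r e \<le> w e" if e: "e \<in> {1..n}" for e
    using r0[OF e] r0[OF abc(1)] r0[OF abc(2)] r0[OF abc(3)] ne d by auto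
  moreover have "(\<Sum>e=1..n. w e - ?r e) \<le> (\<Sum>e=1..n. (w e - ?r e) * \<phi> e)"
    if \<phi>: "\<forall>a\<in>{1..n}. \<forall>b\<in>{1..n}. \<forall>c\<in>{1..n}. cyclic ps a b c \<longrightarrow> 3 \<le> \<phi> a + \<phi> b + \<phi> c" for \<phi>
  proof -
    have "(\<Sum>e=1..n. w e - ?r e) = (\<Sum>e=1..n. w e - r e) + (\<Sum>e=1..n. d * of_bool (e \<in> ?T) * 1)"
      unfolding r' sum.distrib[symmetric] by (intro sum.cong) auto
    also have "(\<Sum>e=1..n. d * of_bool (e \<in> ?T) * 1) = d * 3"
      using ne by (subst sum_mult_of_bool[OF T]) auto
    finally have 1: "(\<Sum>e=1..n. w e - ?r e) = (\<Sum>e=1..n. w e - r e) + d * 3" .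
    have "(\<Sum>e=1..n. (w e - ?r e) * \<phi> e) =
        (\<Sum>e=1..n. (w e - r e) * \<phi> e) + (\<Sum>e=1..n. d * of_bool (e \<in> ?T) * \<phi> e)"
      unfolding r' sum.distrib[symmetric] by (intro sum.cong) (auto simp: algebra_simps)
    also have "(\<Sum>e=1..n. d * of_bool (e \<in> ?T) * \<phi> e) = d * (\<phi> a + \<phi> b + \<phi> c)"
      using ne by (subst sum_mult_of_bool[OF T]) auto
    finally have 2: "(\<Sum>e=1..n. (w e - ?r e) * \<phi> e) = (\<Sum>e=1..n. (w e - r e) * \<phi> e) + d * (\<phi> a + \<phi> b + \<phi> c)" .
    have "d * 3 \<le> d * (\<phi> a + \<phi> b + \<phi> c)"
      using \<phi> abc cyc \<open>0 \<le> d\<close> by (intro mult_left_mono) auto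
    moreover have "(\<Sum>e=1..n. w e - r e) \<le> (\<Sum>e=1..n. (w e - r e) * \<phi> e)"
      using r \<phi> unfolding partial_cover_def by blast
    ultimately show ?thesis unfolding 1 2 by linarith
  qed
  ultimately show ?thesis unfolding partial_cover_def by blast
qed

section \<open>Correctness of the charging pass\<close>

context median_instance
begin

lemma cyclic_distinct:
  assumes "a \<in> {1..n}" "b \<in> {1..n}" "c \<in> {1..n}" "cyclic ps a b c"
  shows "a \<noteq> b" "b \<noteq> c" "c \<noteq> a"
  using maj_asym[OF ps, of a a] maj_asym[OF ps, of b b] maj_asym[OF ps, of c c] assms
  unfolding cyclic_def by auto

text \<open>\<open>D\<close> collects the counter triples visited so far; counters start at 0 and
  elements at 1, hence \<open>Suc\<close>.\<close>

definition reduced :: "(nat \<times> nat \<times> nat) set \<Rightarrow> (nat \<Rightarrow> real) \<Rightarrow> bool" where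
  "reduced D r \<longleftrightarrow> partial_cover ps n w r \<and>
     (\<forall>(a, b, c)\<in>D. cyclic ps (Suc a) (Suc b) (Suc c) \<longrightarrow> r (Suc a) = 0 \<or> r (Suc b) = 0 \<or> r (Suc c) = 0)"

lemma reduced_charge:
  assumes "reduced D r" "a < n" "b < n" "c < n" "D \<subseteq> {..<n} \<times> {..<n} \<times> {..<n}"
    and "cyclic ps (Suc a) (Suc b) (Suc c)"
    and "d = min (r (Suc a)) (min (r (Suc b)) (r (Suc c)))"
  shows "reduced (insert (a, b, c) D)
    (r(Suc a := r (Suc a) - d, Suc b := r (Suc b) - d, Suc c := r (Suc c) - d))" (is "reduced _ ?r")
proof -
  have ne: "a \<noteq> b" "b \<noteq> c" "c \<noteq> a"
    using cyclic_distinct[of "Suc a" "Suc b" "Suc c"] assms by auto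
  have cover: "partial_cover ps n w r" using assms(1) unfolding reduced_def by simp
  then have r0: "0 \<le> r e" if "e \<in> {1..n}" for e
    using that unfolding partial_cover_def by auto
  \<comment> \<open>If a member of the triple already has residual 0, then \<open>d = 0\<close> and
    nothing changes.\<close>
  have mono: "?r (Suc e) = 0" if "e < n" "r (Suc e) = 0" for e
    using that r0[of "Suc a"] r0[of "Suc b"] r0[of "Suc c"] assms(2-4,7) ne by auto
  have "partial_cover ps n w ?r"
    using assms ne by (intro partial_cover_charge cover) auto
  moreover have "?r (Suc a) = 0 \<or> ?r (Suc b) = 0 \<or> ?r (Suc c) = 0"
    using ne assms(7) by (auto simp: min_def)
  moreover have "?r (Suc a') = 0 \<or> ?r (Suc b') = 0 \<or> ?r (Suc c') = 0"
    if D: "(a', b', c') \<in> D" and "cyclic ps (Suc a') (Suc b') (Suc c')" for a' b' c'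
  proof -
    have "r (Suc a') = 0 \<or> r (Suc b') = 0 \<or> r (Suc c') = 0"
      using assms(1) that unfolding reduced_def by blast
    moreover have "a' < n" "b' < n" "c' < n" using D assms(5) by auto
    ultimately show ?thesis using mono by blast
  qed
  ultimately show ?thesis unfolding reduced_def by blast
qed

lemma run_reduce_step:
  assumes "base s" "majorities (nats s ''E'')" "reduced D (reals s ''r'')"
    and "D \<subseteq> {..<n} \<times> {..<n} \<times> {..<n}"
    and abc: "nats s ''a'' 0 = a" "nats s ''b'' 0 = b" "nats s ''c'' 0 = c" "a < n" "b < n" "c < n"
  shows "reduced (insert (a, b, c) D) (reals (run reduce_step s) ''r'')"
proof (cases "cyclic ps (Suc a) (Suc b) (Suc c)")
  case True
  have ne: "a \<noteq> b" "b \<noteq> c" "c \<noteq> a"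
    using cyclic_distinct[of "Suc a" "Suc b" "Suc c"] True abc by auto
  define r where "r = reals s ''r''"
  define d where "d = min (r (Suc a)) (min (r (Suc b)) (r (Suc c)))"
  \<comment> \<open>The three charges run one after the other; distinctness ensures that each reads
    a residual not yet altered.\<close>
  have "reals (run reduce_step s) ''r'' =
    r(Suc a := r (Suc a) - d, Suc b := r (Suc b) - d, Suc c := r (Suc c) - d)"
    using assms True ne majoritiesD[OF assms(2)]
    by (auto simp: reduce_step_def has_edge_def lower_to_def charge_def cyclic_def r_def d_def fun_eq_iff)
  then show ?thesis using reduced_charge[OF assms(3), of a b c d] True assms(4) abc
    unfolding r_def d_def by simp
next
  case False
  then have "run reduce_step s = s"
    using assms majoritiesD[OF assms(2)] by (auto simp: reduce_step_def has_edge_def cyclic_def)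
  then show ?thesis using False assms(3) unfolding reduced_def by auto
qed

lemma iter_reduce_step:
  assumes "base s" "majorities (nats s ''E'')" "reduced D (reals s ''r'')"
    and "D \<subseteq> {..<n} \<times> {..<n} \<times> {..<n}"
    and "nats s ''a'' 0 = a" "nats s ''b'' 0 = b" "a < n" "b < n" "k \<le> n"
  shows "reduced (D \<union> {a} \<times> {b} \<times> {..<k}) (reals (iter ''c'' reduce_step s k) ''r'')"
  using assms(9)
proof (induction k)
  case (Suc k)
  let ?s = "iter ''c'' reduce_step s k"
  note defs = reduce_step_def lower_to_def charge_def
  have "base ?s" using assms(1) by (simp add: frame defs)
  moreover have "majorities (nats ?s ''E'')" using assms(2) by (simp add: frame defs)
  moreover have "nats ?s ''c'' 0 = k" by (simp add: frame defs)
  moreover have "nats ?s ''a'' 0 = a" "nats ?s ''b'' 0 = b" using assms(5,6) by (simp_all add: frame defs)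
  moreover have "D \<union> {a} \<times> {b} \<times> {..<k} \<subseteq> {..<n} \<times> {..<n} \<times> {..<n}"
    using assms(4,7,8) Suc.prems by auto
  moreover have "D \<union> {a} \<times> {b} \<times> {..<Suc k} = insert (a, b, k) (D \<union> {a} \<times> {b} \<times> {..<k})"
    by (auto simp: lessThan_Suc)
  ultimately show ?case
    using run_reduce_step[of ?s "D \<union> {a} \<times> {b} \<times> {..<k}" a b k] Suc assms(7,8) by simp
qed (use assms in simp)

lemma iter_reduce_row:
  assumes "base s" "majorities (nats s ''E'')" "reduced D (reals s ''r'')"
    and "D \<subseteq> {..<n} \<times> {..<n} \<times> {..<n}"
    and "nats s ''a'' 0 = a" "a < n" "k \<le> n"
  shows "reduced (D \<union> {a} \<times> {..<k} \<times> {..<n}) (reals (iter ''b'' reduce_row s k) ''r'')"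
  using assms(7)
proof (induction k)
  case (Suc k)
  let ?s = "iter ''b'' reduce_row s k"
  note defs = reduce_row_def reduce_step_def lower_to_def charge_def
  have "base ?s" using assms(1) by (simp add: frame defs)
  moreover have "majorities (nats ?s ''E'')" using assms(2) by (simp add: frame defs)
  moreover have "nats ?s ''b'' 0 = k" by (simp add: frame defs)
  moreover have "nats ?s ''a'' 0 = a" using assms(5) by (simp add: frame defs)
  moreover have "D \<union> {a} \<times> {..<k} \<times> {..<n} \<subseteq> {..<n} \<times> {..<n} \<times> {..<n}"
    using assms(4,6) Suc.prems by auto
  moreover have "D \<union> {a} \<times> {..<Suc k} \<times> {..<n} = (D \<union> {a} \<times> {..<k} \<times> {..<n}) \<union> {a} \<times> {k} \<times> {..<n}"
    by (auto simp: lessThan_Suc)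
  ultimately show ?case
    using iter_reduce_step[of ?s "D \<union> {a} \<times> {..<k} \<times> {..<n}" a k n] Suc assms(6)
    by (simp add: reduce_row_def run_LFor)
qed (use assms in simp)

lemma iter_reduce_rows:
  assumes "base s" "majorities (nats s ''E'')" "reduced {} (reals s ''r'')" "k \<le> n"
  shows "reduced ({..<k} \<times> {..<n} \<times> {..<n}) (reals (iter ''a'' reduce_rows s k) ''r'')"
  using assms(4)
proof (induction k)
  case (Suc k)
  let ?s = "iter ''a'' reduce_rows s k"
  note defs = reduce_rows_def reduce_row_def reduce_step_def lower_to_def charge_def
  have "base ?s" using assms(1) by (simp add: frame defs)
  moreover have "majorities (nats ?s ''E'')" using assms(2) by (simp add: frame defs)
  moreover have "nats ?s ''a'' 0 = k" by (simp add: frame defs)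
  moreover have "{..<k} \<times> {..<n} \<times> {..<n} \<subseteq> {..<n} \<times> {..<n} \<times> {..<n}"
    using Suc.prems by auto
  moreover have "{..<Suc k} \<times> {..<n} \<times> {..<n} = {..<k} \<times> {..<n} \<times> {..<n} \<union> {k} \<times> {..<n} \<times> {..<n}"
    by (auto simp: lessThan_Suc)
  ultimately show ?case
    using iter_reduce_row[of ?s "{..<k} \<times> {..<n} \<times> {..<n}" k n] Suc
    by (simp add: reduce_rows_def run_LFor)
qed (use assms in simp)

lemma iter_init_step:
  assumes "base s" "k \<le> n" "e \<in> {1..k}"
  shows "reals (iter ''a'' init_step s k) ''r'' e = w e"
  using assms(2,3)
proof (induction k)
  case (Suc k)
  let ?s = "iter ''a'' init_step s k"
  have "base ?s" using assms(1) by (simp add: frame init_step_def)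
  moreover have "nats ?s ''a'' 0 = k" by (simp add: frame init_step_def)
  ultimately show ?case using Suc by (auto simp: init_step_def)
qed simp

lemma reduced_reduce_prog:
  assumes "base s" "majorities (nats s ''E'')"
  shows "partial_cover ps n w (reals (run reduce_prog s) ''r'')"
    and "acyclic_support ps n (reals (run reduce_prog s) ''r'')"
proof -
  define s1 where "s1 = iter ''a'' init_step s n"
  have "base s1" "majorities (nats s1 ''E'')"
    using assms by (simp_all add: s1_def frame init_step_def)
  moreover have "reals s1 ''r'' e = w e" if "e \<in> {1..n}" for e
    using iter_init_step[OF assms(1) order_refl] that unfolding s1_def by simp
  \<comment> \<open>Initially \<open>r = w\<close> on the elements, so nothing is spent and both
    sums vanish.\<close>
  then have "partial_cover ps n w (reals s1 ''r'')"
    using wpos unfolding partial_cover_def by (auto intro!: sum.neutral simp: less_imp_le)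
  then have "reduced {} (reals s1 ''r'')" unfolding reduced_def by simp
  ultimately have "reduced ({..<n} \<times> {..<n} \<times> {..<n}) (reals (iter ''a'' reduce_rows s1 n) ''r'')"
    by (intro iter_reduce_rows) auto
  moreover have "run reduce_prog s = iter ''a'' reduce_rows s1 n"
    using assms(1) \<open>base s1\<close> unfolding reduce_prog_def s1_def by (simp add: run_LFor)
  ultimately have red: "reduced ({..<n} \<times> {..<n} \<times> {..<n}) (reals (run reduce_prog s) ''r'')" by simp
  then show "partial_cover ps n w (reals (run reduce_prog s) ''r'')" unfolding reduced_def by simp
  show "acyclic_support ps n (reals (run reduce_prog s) ''r'')"
    unfolding acyclic_support_def
  proof (intro ballI impI)
    fix a b c assume abc: "a \<in> {1..n}" "b \<in> {1..n}" "c \<in> {1..n}" and cyc: "cyclic ps a b c"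
    then have "(a - 1, b - 1, c - 1) \<in> {..<n} \<times> {..<n} \<times> {..<n}" by auto
    with red have "cyclic ps (Suc (a - 1)) (Suc (b - 1)) (Suc (c - 1)) \<longrightarrow>
      reals (run reduce_prog s) ''r'' (Suc (a - 1)) = 0 \<or> reals (run reduce_prog s) ''r'' (Suc (b - 1)) = 0 \<or>
      reals (run reduce_prog s) ''r'' (Suc (c - 1)) = 0"
      unfolding reduced_def by blast
    then show "reals (run reduce_prog s) ''r'' a = 0 \<or> reals (run reduce_prog s) ''r'' b = 0 \<or>
      reals (run reduce_prog s) ''r'' c = 0"
      using abc cyc by simp
  qed
qed

end

section \<open>Ranking and selection\<close>

text \<open>The order of the constructed candidate. On \<open>{1..n}\<close> acyclic support makes
  it a strict linear order; the numerical order of the elements without residual weight is an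
  arbitrary choice.\<close>

definition placed :: "nat list list \<Rightarrow> (nat \<Rightarrow> real) \<Rightarrow> nat \<Rightarrow> nat \<Rightarrow> bool" where
  "placed ps r a b \<longleftrightarrow> 0 < r a \<and> (0 < r b \<longrightarrow> maj ps a b) \<or> \<not> 0 < r a \<and> \<not> 0 < r b \<and> a < b"

abbreviation positive :: "nexp \<Rightarrow> bexp" where
  "positive a \<equiv> RLess (RConst 0) (residual a)"

definition tally_step :: loop_prog where
  "tally_step = LIf
     (Or (And (positive (V ''b'')) (Or (Not (positive (V ''a''))) (has_edge (V ''b'') (V ''a''))))
         (And (And (Not (positive (V ''b''))) (Not (positive (V ''a'')))) (NLess (V ''b'') (V ''a''))))
     (LNat ''R'' (NConst 0) (NPlus (V ''R'') (NConst 1)))"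

text \<open>The constructed permutation becomes row \<open>m\<close> of \<open>P\<close>, following the input permutations.\<close>

definition rank_step :: loop_prog where
  "rank_step = LSeq (LNat ''R'' (NConst 0) (NConst 0)) (LSeq (LFor ''b'' (V ''n'') tally_step)
     (LNat ''P'' (cell (V ''m'') (V ''R'')) (NPlus (V ''a'') (NConst 1))))"

definition rank_prog :: loop_prog where
  "rank_prog = LFor ''a'' (V ''n'') rank_step"

text \<open>
  \<open>h k\<close> is the largest weight of a common subsequence of candidate \<open>c\<close> and input \<open>j\<close> that ends with the
  \<open>k\<close>-th entry of the candidate, \<open>v\<close> the best value of \<open>h\<close> among possible predecessors, \<open>x\<close> the
  maximum of \<open>h\<close>. The score \<open>g\<close> of a candidate sums \<open>x\<close> over the inputs; \<open>t\<close> and \<open>z\<close> are the best score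
  and its candidate.
\<close>

definition pred_step :: loop_prog where
  "pred_step = LIf
     (And (And (NLess (V ''l'') (V ''k''))
       (precedes (NMinus (NAt ''P'' (cell (V ''c'') (V ''l''))) (NConst 1))
          (NMinus (NAt ''P'' (cell (V ''c'') (V ''k''))) (NConst 1))))
       (RLess (RV ''v'') (RAt ''h'' (V ''l''))))
     (LReal ''v'' (NConst 0) (RAt ''h'' (V ''l'')))"

definition chain_step :: loop_prog where
  "chain_step = LSeq (LReal ''v'' (NConst 0) (RConst 0)) (LSeq (LFor ''l'' (V ''n'') pred_step)
    (LSeq (LReal ''h'' (V ''k'') (RPlus (RAt ''w'' (NAt ''P'' (cell (V ''c'') (V ''k'')))) (RV ''v'')))
          (LIf (RLess (RV ''x'') (RAt ''h'' (V ''k''))) (LReal ''x'' (NConst 0) (RAt ''h'' (V ''k''))))))"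

definition score_step :: loop_prog where
  "score_step = LSeq (LReal ''x'' (NConst 0) (RConst 0)) (LSeq (LFor ''k'' (V ''n'') chain_step)
     (LReal ''g'' (NConst 0) (RPlus (RV ''g'') (RV ''x''))))"

definition select_step :: loop_prog where
  "select_step = LSeq (LReal ''g'' (NConst 0) (RConst 0)) (LSeq (LFor ''j'' (V ''m'') score_step)
     (LIf (Not (RLess (RV ''g'') (RV ''t'')))
       (LSeq (LReal ''t'' (NConst 0) (RV ''g'')) (LNat ''z'' (NConst 0) (V ''c'')))))"

definition select_prog :: loop_prog where
  "select_prog = LSeq (LReal ''t'' (NConst 0) (RConst 0)) (LSeq (LNat ''z'' (NConst 0) (NConst 0))
     (LFor ''c'' (NPlus (V ''m'') (NConst 1)) select_step))"

definition output_step :: loop_prog where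
  "output_step = LNat ''y'' (V ''i'') (NAt ''P'' (cell (V ''z'') (V ''i'')))"

definition output_prog :: loop_prog where
  "output_prog = LFor ''i'' (V ''n'') output_step"

definition median_prog :: loop_prog where
  "median_prog = LSeq multiples_prog (LSeq pos_prog (LSeq maj_prog (LSeq reduce_prog
     (LSeq rank_prog (LSeq select_prog output_prog)))))"

section \<open>Correctness of the ranking\<close>

context median_instance
begin

definition order_rank :: "(nat \<Rightarrow> real) \<Rightarrow> nat \<Rightarrow> nat" where
  "order_rank r a = (\<Sum>b<n. of_bool (placed ps r (Suc b) a))"

lemma order_rank_card: "order_rank r a = card {b \<in> {1..n}. placed ps r b a}"
proof -
  have "order_rank r a = (\<Sum>b=1..n. of_bool (placed ps r b a))"
    unfolding order_rank_def One_nat_def by (rule sum.atLeast1_atMost_eq[symmetric])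
  then show ?thesis by (simp add: Int_def)
qed

context
  fixes r :: "nat \<Rightarrow> real"
  assumes r: "acyclic_support ps n r"
begin

lemma placed_irrefl: "a \<in> {1..n} \<Longrightarrow> \<not> placed ps r a a"
  using maj_asym[OF ps, of a a] unfolding placed_def by blast

lemma placed_total: "a \<in> {1..n} \<Longrightarrow> b \<in> {1..n} \<Longrightarrow> a \<noteq> b \<Longrightarrow> placed ps r a b \<or> placed ps r b a"
  using maj_total[OF ps, of a b] unfolding placed_def by (auto simp: not_less)

text \<open>Among three elements of positive residual, a majority edge from \<open>c\<close> back to
  \<open>a\<close> would close a cycle, which acyclic support forbids. All other cases follow from
  the block structure and the numerical order.\<close>

lemma placed_trans:
  assumes abc: "a \<in> {1..n}" "b \<in> {1..n}" "c \<in> {1..n}" and ab: "placed ps r a b" and bc: "placed ps r b c"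
  shows "placed ps r a c"
proof (cases "0 < r a \<and> 0 < r b \<and> 0 < r c")
  case True
  then have m: "maj ps a b" "maj ps b c" using ab bc unfolding placed_def by auto
  then have "a \<noteq> c" using maj_asym[OF ps] abc by blast
  moreover have "\<not> maj ps c a"
    using r True m abc unfolding acyclic_support_def cyclic_def by force
  ultimately show ?thesis using maj_total[OF ps, of a c] abc True unfolding placed_def by blast
next
  case False
  then show ?thesis using ab bc unfolding placed_def by auto
qed

text \<open>Transitivity nests the predecessor sets, and \<open>a\<close> itself makes the inclusion
  strict. With totality, ranks are therefore distinct and usable as positions.\<close>

lemma order_rank_mono:
  assumes "a \<in> {1..n}" "b \<in> {1..n}" "placed ps r a b"
  shows "order_rank r a < order_rank r b"
  unfolding order_rank_card
proof (rule psubset_card_mono)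
  show "{c \<in> {1..n}. placed ps r c a} \<subset> {c \<in> {1..n}. placed ps r c b}"
    using assms placed_trans placed_irrefl[of a] by blast
qed simp

lemma order_rank_less:
  assumes "a \<in> {1..n}"
  shows "order_rank r a < n"
proof -
  have "{c \<in> {1..n}. placed ps r c a} \<subset> {1..n}" using assms placed_irrefl[of a] by blast
  from psubset_card_mono[OF _ this] show ?thesis unfolding order_rank_card by simp
qed

lemma order_rank_eq_iff:
  assumes "a \<in> {1..n}" "b \<in> {1..n}"
  shows "order_rank r a = order_rank r b \<longleftrightarrow> a = b"
  using placed_total[OF assms] order_rank_mono[OF assms] order_rank_mono[OF assms(2,1)] by fastforce

text \<open>All \<open>n\<close> elements occur in a list of length \<open>n\<close>, so by counting
  there are no repetitions.\<close>

lemma ranked_list: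
  assumes y: "length y = n" "\<And>a. a \<in> {1..n} \<Longrightarrow> y ! order_rank r a = a"
  shows "y \<in> perms n"
    and "\<And>a b. a \<in> {1..n} \<Longrightarrow> b \<in> {1..n} \<Longrightarrow> 0 < r a \<Longrightarrow> 0 < r b \<Longrightarrow> maj ps a b \<Longrightarrow> bef y a b"
proof -
  have "{1..n} \<subseteq> set y"
  proof
    fix a assume "a \<in> {1..n}"
    then show "a \<in> set y" using y order_rank_less[of a] by (metis nth_mem)
  qed
  moreover have "card (set y) \<le> card {1..n}" using card_length[of y] y(1) by simp
  ultimately have "set y = {1..n}" by (metis List.finite_set card_seteq)
  moreover from this have "distinct y" using y(1) by (intro card_distinct) simp
  ultimately show "y \<in> perms n" by (rule permutations_of_setI)
  show "bef y a b" if "a \<in> {1..n}" "b \<in> {1..n}" "0 < r a" "0 < r b" "maj ps a b" for a b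
    unfolding bef_def using that y order_rank_mono[of a b] order_rank_less[of b]
    by (intro exI[of _ "order_rank r a"] exI[of _ "order_rank r b"]) (simp add: placed_def)
qed

lemma iter_tally_step:
  assumes "base s" "majorities (nats s ''E'')" "reals s ''r'' = r" "nats s ''R'' 0 = 0"
    and "nats s ''a'' 0 = a" "a < n" "k \<le> n"
  shows "nats (iter ''b'' tally_step s k) ''R'' 0 = (\<Sum>b<k. of_bool (placed ps r (Suc b) (Suc a)))"
  using assms(7)
proof (induction k)
  case (Suc k)
  let ?s = "iter ''b'' tally_step s k"
  have "base ?s" using assms(1) by (simp add: frame tally_step_def)
  moreover have "majorities (nats ?s ''E'')" using assms(2) by (simp add: frame tally_step_def)
  moreover have "nats ?s ''b'' 0 = k" by (simp add: frame tally_step_def)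
  moreover have "nats ?s ''a'' 0 = a" using assms(5) by (simp add: frame tally_step_def)
  moreover have "reals ?s ''r'' = r" using assms(3) by (simp add: frame tally_step_def)
  ultimately show ?case
    using Suc assms(6) majoritiesD[of "nats ?s ''E''" k a]
    by (auto simp: tally_step_def has_edge_def placed_def)
qed (use assms in simp)

lemma run_rank_step:
  assumes "base s" "majorities (nats s ''E'')" "reals s ''r'' = r" "nats s ''a'' 0 = a" "a < n"
  shows "nats (run rank_step s) ''P'' =
    (nats s ''P'')(length ps * n + order_rank r (Suc a) := Suc a)"
proof -
  define s1 where "s1 = nset ''R'' 0 0 s"
  define s2 where "s2 = iter ''b'' tally_step s1 n"
  have s1: "base s1" "majorities (nats s1 ''E'')" "reals s1 ''r'' = r" "nats s1 ''R'' 0 = 0"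
    "nats s1 ''a'' 0 = a" "nats s1 ''P'' = nats s ''P''"
    using assms by (simp_all add: s1_def frame nats_nset_other)
  then have s2: "base s2" "nats s2 ''a'' 0 = a" "nats s2 ''P'' = nats s ''P''"
    by (simp_all add: s2_def frame tally_step_def)
  have "nats s2 ''R'' 0 = order_rank r (Suc a)"
    unfolding s2_def order_rank_def by (rule iter_tally_step) (use s1 assms in auto)
  moreover have "run rank_step s = run (LNat ''P'' (cell (V ''m'') (V ''R'')) (NPlus (V ''a'') (NConst 1))) s2"
    using assms(1) unfolding rank_step_def s2_def s1_def by (simp add: run_LFor)
  ultimately show ?thesis using s2 by (auto simp: fun_eq_iff)
qed

text \<open>All writes go to addresses from \<open>length ps * n\<close> on, so the inputs survive,
  and distinct ranks keep the new entries from overwriting each other.\<close>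

lemma iter_rank_step:
  assumes "base s" "majorities (nats s ''E'')" "reals s ''r'' = r" "k \<le> n"
  shows "\<forall>a\<in>{1..k}. nats (iter ''a'' rank_step s k) ''P'' (length ps * n + order_rank r a) = a"
    and "\<forall>i < length ps * n. nats (iter ''a'' rank_step s k) ''P'' i = nats s ''P'' i"
proof -
  have "(\<forall>a\<in>{1..k}. nats (iter ''a'' rank_step s k) ''P'' (length ps * n + order_rank r a) = a) \<and>
    (\<forall>i < length ps * n. nats (iter ''a'' rank_step s k) ''P'' i = nats s ''P'' i)"
    using assms(4)
  proof (induction k)
    case (Suc k)
    let ?s = "iter ''a'' rank_step s k"
    note defs = rank_step_def tally_step_def
    have "base ?s" using assms(1) by (simp add: frame defs)
    moreover have "majorities (nats ?s ''E'')" using assms(2) by (simp add: frame defs)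
    moreover have "nats ?s ''a'' 0 = k" by (simp add: frame defs)
    moreover have "reals ?s ''r'' = r" using assms(3) by (simp add: frame defs)
    ultimately have P: "nats (run rank_step ?s) ''P'' =
      (nats ?s ''P'')(length ps * n + order_rank r (Suc k) := Suc k)"
      using Suc.prems by (intro run_rank_step) auto
    have "nats (iter ''a'' rank_step s (Suc k)) ''P'' (length ps * n + order_rank r a) = a"
      if "a \<in> {1..Suc k}" for a
      using P Suc that order_rank_eq_iff[of a "Suc k"] by (cases "a = Suc k") auto
    moreover have "nats (iter ''a'' rank_step s (Suc k)) ''P'' i = nats s ''P'' i" if "i < length ps * n" for i
      using P Suc that by auto
    ultimately show ?case by blast
  qed simp
  then show "\<forall>a\<in>{1..k}. nats (iter ''a'' rank_step s k) ''P'' (length ps * n + order_rank r a) = a"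
    "\<forall>i < length ps * n. nats (iter ''a'' rank_step s k) ''P'' i = nats s ''P'' i" by blast+
qed

end

section \<open>Scoring the candidates and selecting the best one\<close>

definition scoring :: "nat list list \<Rightarrow> state \<Rightarrow> bool" where
  "scoring xs s \<longleftrightarrow> base s \<and> rows xs (nats s ''P'') \<and> positions (nats s ''pos'')"

lemma scoring_frame:
  "{''n'', ''m'', ''M'', ''P'', ''pos''} \<inter> nat_writes c = {} \<Longrightarrow> ''w'' \<notin> real_writes c \<Longrightarrow>
    scoring xs (run c s) \<longleftrightarrow> scoring xs s"
  "{''n'', ''m'', ''M'', ''P'', ''pos''} \<inter> insert v (nat_writes c) = {} \<Longrightarrow> ''w'' \<notin> real_writes c \<Longrightarrow>
    scoring xs (iter v c s k) \<longleftrightarrow> scoring xs s"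
  "a \<notin> {''n'', ''m'', ''M'', ''P'', ''pos''} \<Longrightarrow> scoring xs (nset a i e s) \<longleftrightarrow> scoring xs s"
  "a \<noteq> ''w'' \<Longrightarrow> scoring xs (rset a i u s) \<longleftrightarrow> scoring xs s"
  unfolding scoring_def by (auto simp: frame nats_nset_other)

context
  fixes xs :: "nat list list"
  assumes xs: "set xs \<subseteq> perms n" "length xs \<le> Suc (length ps)"
begin

abbreviation chain_rel :: "nat \<Rightarrow> nat \<Rightarrow> nat \<Rightarrow> nat \<Rightarrow> bool" where
  "chain_rel c j \<equiv> \<lambda>l i. bef (ps ! j) (xs ! c ! l) (xs ! c ! i)"

lemma candidate_range:
  assumes "c < length xs" "i < n"
  shows "0 < xs ! c ! i" "xs ! c ! i \<le> n"
  using permsD[OF subsetD[OF xs(1) nth_mem[OF assms(1)]]] nth_mem[of i "xs ! c"] assms(2) by auto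

text \<open>The loop runs up to \<open>n\<close>, since loop bounds may read only arrays that the
  program never writes. Its guard idles all passes from \<open>k\<close> on, hence
  \<open>min l k\<close>.\<close>

lemma iter_pred_step:
  assumes "scoring xs s" "nats s ''c'' 0 = c" "nats s ''j'' 0 = j" "nats s ''k'' 0 = k"
    and "c < length xs" "j < length ps" "k < n" "reals s ''v'' 0 = 0" "l \<le> n"
  shows "reals (iter ''l'' pred_step s l) ''v'' 0 = best_pred (chain_rel c j) (reals s ''h'') k (min l k)"
  using assms(9)
proof (induction l)
  case (Suc l)
  let ?s = "iter ''l'' pred_step s l"
  have sc: "scoring xs ?s" using assms(1) by (simp add: scoring_frame pred_step_def)
  then have "base ?s" "rows xs (nats ?s ''P'')" "positions (nats ?s ''pos'')"
    unfolding scoring_def by auto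
  moreover have "nats ?s ''l'' 0 = l" by (simp add: frame pred_step_def)
  moreover have "nats ?s ''c'' 0 = c" "nats ?s ''j'' 0 = j" "nats ?s ''k'' 0 = k" "reals ?s ''h'' = reals s ''h''"
    using assms(2-4) by (simp_all add: frame pred_step_def)
  ultimately show ?case
    using Suc assms(5-7) xs(2) rowsD[of xs "nats ?s ''P''" c l] rowsD[of xs "nats ?s ''P''" c k]
      positionsD[of "nats ?s ''pos''" j "xs ! c ! l" "xs ! c ! k"]
      candidate_range[of c l] candidate_range[of c k]
    by (cases "l < k") (simp_all add: pred_step_def precedes_def min_def)
qed (use assms in simp)

lemma run_chain_step:
  assumes "scoring xs s" "nats s ''c'' 0 = c" "nats s ''j'' 0 = j" "nats s ''k'' 0 = k"
    and "c < length xs" "j < length ps" "k < n"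
    and H: "H = w (xs ! c ! k) + best_pred (chain_rel c j) (reals s ''h'') k k"
  shows "reals (run chain_step s) ''h'' = (reals s ''h'')(k := H)"
    and "reals (run chain_step s) ''x'' 0 = (if reals s ''x'' 0 < H then H else reals s ''x'' 0)"
proof -
  define s1 where "s1 = rset ''v'' 0 0 s"
  define s2 where "s2 = iter ''l'' pred_step s1 n"
  have s1: "scoring xs s1" "nats s1 ''c'' 0 = c" "nats s1 ''j'' 0 = j" "nats s1 ''k'' 0 = k"
    "reals s1 ''v'' 0 = 0" "reals s1 ''h'' = reals s ''h''" "reals s1 ''x'' = reals s ''x''"
    using assms by (simp_all add: s1_def scoring_frame reals_rset_other)
  then have s2: "scoring xs s2" "nats s2 ''c'' 0 = c" "nats s2 ''k'' 0 = k"
    "reals s2 ''h'' = reals s ''h''" "reals s2 ''x'' = reals s ''x''"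
    by (simp_all add: s2_def scoring_frame frame pred_step_def)
  have v: "reals s2 ''v'' 0 = best_pred (chain_rel c j) (reals s ''h'') k k"
    using iter_pred_step[OF s1(1-4) assms(5-7) s1(5) order_refl] s1(6) assms(7)
    unfolding s2_def by (simp add: min_def)
  have b: "base s2" "rows xs (nats s2 ''P'')" using s2(1) unfolding scoring_def by auto
  have "base s" using assms(1) unfolding scoring_def by auto
  then have run: "run chain_step s = run (LSeq (LReal ''h'' (V ''k'') (RPlus (RAt ''w'' (NAt ''P'' (cell (V ''c'') (V ''k'')))) (RV ''v'')))
          (LIf (RLess (RV ''x'') (RAt ''h'' (V ''k''))) (LReal ''x'' (NConst 0) (RAt ''h'' (V ''k''))))) s2"
    unfolding chain_step_def s2_def s1_def by (simp add: run_LFor)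
  show "reals (run chain_step s) ''h'' = (reals s ''h'')(k := H)"
    "reals (run chain_step s) ''x'' 0 = (if reals s ''x'' 0 < H then H else reals s ''x'' 0)"
    using s2 b v xs(2) assms(5,7) rowsD[OF b(2) assms(5,7)] candidate_range[OF assms(5,7)]
    unfolding run H by (auto simp: fun_eq_iff)
qed

text \<open>Cells of \<open>h\<close> from \<open>k\<close> on may hold values of an earlier input.
  This is harmless: the recurrence at \<open>i\<close> reads only cells below \<open>i\<close>,
  which the present loop has already rewritten, and writing cell \<open>k\<close> leaves the earlier
  equations intact.\<close>

lemma iter_chain_step:
  assumes "scoring xs s" "nats s ''c'' 0 = c" "nats s ''j'' 0 = j" "c < length xs" "j < length ps"
    and "reals s ''x'' 0 = 0" "k \<le> n"
  shows "\<forall>i<k. reals (iter ''k'' chain_step s k) ''h'' i =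
      w (xs ! c ! i) + best_pred (chain_rel c j) (reals (iter ''k'' chain_step s k) ''h'') i i"
    and "reals (iter ''k'' chain_step s k) ''x'' 0 = running_max (reals (iter ''k'' chain_step s k) ''h'') k"
proof -
  have "(\<forall>i<k. reals (iter ''k'' chain_step s k) ''h'' i =
      w (xs ! c ! i) + best_pred (chain_rel c j) (reals (iter ''k'' chain_step s k) ''h'') i i) \<and>
    reals (iter ''k'' chain_step s k) ''x'' 0 = running_max (reals (iter ''k'' chain_step s k) ''h'') k"
    using assms(7)
  proof (induction k)
    case (Suc k)
    let ?s = "iter ''k'' chain_step s k"
    define h where "h = reals ?s ''h''"
    define h' where "h' = reals (run chain_step ?s) ''h''"
    note defs = chain_step_def pred_step_def
    have sc: "scoring xs ?s" using assms(1) by (simp add: scoring_frame defs)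
    have "nats ?s ''k'' 0 = k" by (simp add: frame defs)
    moreover have "nats ?s ''c'' 0 = c" "nats ?s ''j'' 0 = j" using assms(2,3) by (simp_all add: frame defs)
    ultimately have h': "h' = h(k := w (xs ! c ! k) + best_pred (chain_rel c j) h k k)"
      and x: "reals (run chain_step ?s) ''x'' 0 = (if reals ?s ''x'' 0 < h' k then h' k else reals ?s ''x'' 0)"
      using run_chain_step[OF sc _ _ _ assms(4,5), of k] Suc.prems unfolding h_def h'_def by auto
    have bp: "best_pred (chain_rel c j) h' i i = best_pred (chain_rel c j) h i i" if "i \<le> k" for i
      using that unfolding h' by (intro best_pred_cong) auto
    have rm: "running_max h' k = running_max h k"
      unfolding h' by (intro running_max_cong) auto
    have "h' i = w (xs ! c ! i) + best_pred (chain_rel c j) h' i i" if "i < Suc k" for i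
      using that bp[of i] Suc by (cases "i = k") (auto simp: h' h_def)
    moreover have "reals (run chain_step ?s) ''x'' 0 = running_max h' (Suc k)"
      using x Suc rm by (simp add: h_def)
    ultimately show ?case unfolding h'_def by simp
  qed (use assms in simp)
  then show "\<forall>i<k. reals (iter ''k'' chain_step s k) ''h'' i =
      w (xs ! c ! i) + best_pred (chain_rel c j) (reals (iter ''k'' chain_step s k) ''h'') i i"
    "reals (iter ''k'' chain_step s k) ''x'' 0 = running_max (reals (iter ''k'' chain_step s k) ''h'') k" by blast+
qed

text \<open>The computed maximum is the weight kept in common, that is, total weight minus distance.
  The second claim makes every contribution to a score nonnegative.\<close>

lemma run_score_step:
  assumes "scoring xs s" "nats s ''c'' 0 = c" "nats s ''j'' 0 = j" "c < length xs" "j < length ps"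
  shows "reals (run score_step s) ''g'' 0 = reals s ''g'' 0 + (sum w {1..n} - ulam_dist w (xs ! c) (ps ! j))"
    and "ulam_dist w (xs ! c) (ps ! j) \<le> sum w {1..n}"
proof -
  define s1 where "s1 = rset ''x'' 0 0 s"
  define s2 where "s2 = iter ''k'' chain_step s1 n"
  have s1: "scoring xs s1" "nats s1 ''c'' 0 = c" "nats s1 ''j'' 0 = j" "reals s1 ''x'' 0 = 0"
    "reals s1 ''g'' = reals s ''g''"
    using assms by (simp_all add: s1_def scoring_frame reals_rset_other)
  have s2: "reals s2 ''g'' = reals s ''g''"
    using s1 by (simp add: s2_def frame chain_step_def pred_step_def)
  note chain = iter_chain_step[OF s1(1-3) assms(4,5) s1(4) order_refl, folded s2_def]
  have "xs ! c \<in> perms n" "ps ! j \<in> perms n"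
    using nth_mem[OF assms(4)] xs(1) nth_ps(1)[OF assms(5)] by auto
  then have d: "ulam_dist w (xs ! c) (ps ! j) = sum w {1..n} - running_max (reals s2 ''h'') n"
    using chain(1) wpos by (intro ulam_dist_running_max) auto
  have "base s" using assms(1) unfolding scoring_def by auto
  then have "run score_step s = run (LReal ''g'' (NConst 0) (RPlus (RV ''g'') (RV ''x''))) s2"
    unfolding score_step_def s2_def s1_def by (simp add: run_LFor)
  then show "reals (run score_step s) ''g'' 0 = reals s ''g'' 0 + (sum w {1..n} - ulam_dist w (xs ! c) (ps ! j))"
    using d chain(2) s2 by simp
  show "ulam_dist w (xs ! c) (ps ! j) \<le> sum w {1..n}"
    using d running_max_nonneg[of "reals s2 ''h''" n] by simp
qed

text \<open>Gain and total distance add up to \<open>length ps * sum w {1..n}\<close>, so a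
  candidate of largest gain has the smallest total distance.\<close>

definition gain :: "nat \<Rightarrow> real" where
  "gain c = (\<Sum>j<length ps. sum w {1..n} - ulam_dist w (xs ! c) (ps ! j))"

lemma iter_score_step:
  assumes "scoring xs s" "nats s ''c'' 0 = c" "c < length xs" "k \<le> length ps"
  shows "reals (iter ''j'' score_step s k) ''g'' 0 =
      reals s ''g'' 0 + (\<Sum>j<k. sum w {1..n} - ulam_dist w (xs ! c) (ps ! j))"
    and "0 \<le> (\<Sum>j<k. sum w {1..n} - ulam_dist w (xs ! c) (ps ! j))"
proof -
  have "(reals (iter ''j'' score_step s k) ''g'' 0 =
      reals s ''g'' 0 + (\<Sum>j<k. sum w {1..n} - ulam_dist w (xs ! c) (ps ! j))) \<and>
    0 \<le> (\<Sum>j<k. sum w {1..n} - ulam_dist w (xs ! c) (ps ! j))"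
    using assms(4)
  proof (induction k)
    case (Suc k)
    let ?s = "iter ''j'' score_step s k"
    note defs = score_step_def chain_step_def pred_step_def
    have sc: "scoring xs ?s" using assms(1) by (simp add: scoring_frame defs)
    have c: "nats ?s ''c'' 0 = c" using assms(2) by (simp add: frame defs)
    have j: "nats ?s ''j'' 0 = k" by (simp add: frame defs)
    show ?case using Suc run_score_step[OF sc c j assms(3)] by simp
  qed simp
  then show "reals (iter ''j'' score_step s k) ''g'' 0 =
      reals s ''g'' 0 + (\<Sum>j<k. sum w {1..n} - ulam_dist w (xs ! c) (ps ! j))"
    "0 \<le> (\<Sum>j<k. sum w {1..n} - ulam_dist w (xs ! c) (ps ! j))" by blast+
qed

lemma run_select_step:
  assumes "scoring xs s" "nats s ''c'' 0 = c" "c < length xs"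
  shows "reals (run select_step s) ''t'' 0 = max (reals s ''t'' 0) (gain c)"
    and "nats (run select_step s) ''z'' 0 = (if reals s ''t'' 0 \<le> gain c then c else nats s ''z'' 0)"
    and "0 \<le> gain c"
proof -
  define s1 where "s1 = rset ''g'' 0 0 s"
  define s2 where "s2 = iter ''j'' score_step s1 (length ps)"
  have s1: "scoring xs s1" "nats s1 ''c'' 0 = c" "reals s1 ''g'' 0 = 0"
    "reals s1 ''t'' = reals s ''t''" "nats s1 ''z'' = nats s ''z''"
    using assms by (simp_all add: s1_def scoring_frame reals_rset_other)
  then have s2: "nats s2 ''c'' 0 = c" "reals s2 ''t'' = reals s ''t''" "nats s2 ''z'' = nats s ''z''"
    by (simp_all add: s2_def frame score_step_def chain_step_def pred_step_def)
  note score = iter_score_step[OF s1(1,2) assms(3) order_refl, folded s2_def gain_def]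
  show "0 \<le> gain c" by (rule score(2))
  have "base s" using assms(1) unfolding scoring_def by auto
  then have "run select_step s = run (LIf (Not (RLess (RV ''g'') (RV ''t'')))
       (LSeq (LReal ''t'' (NConst 0) (RV ''g'')) (LNat ''z'' (NConst 0) (V ''c'')))) s2"
    unfolding select_step_def s2_def s1_def by (simp add: run_LFor)
  then show "reals (run select_step s) ''t'' 0 = max (reals s ''t'' 0) (gain c)"
    "nats (run select_step s) ''z'' 0 = (if reals s ''t'' 0 \<le> gain c then c else nats s ''z'' 0)"
    using s2 score(1) s1(3) by auto
qed

lemma iter_select_step:
  assumes "scoring xs s" "reals s ''t'' 0 = 0" "nats s ''z'' 0 = 0" "k \<le> length xs" "0 < k"
  shows "nats (iter ''c'' select_step s k) ''z'' 0 < k"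
    and "reals (iter ''c'' select_step s k) ''t'' 0 = gain (nats (iter ''c'' select_step s k) ''z'' 0)"
    and "\<forall>c<k. gain c \<le> reals (iter ''c'' select_step s k) ''t'' 0"
proof -
  have "nats (iter ''c'' select_step s k) ''z'' 0 < k \<and>
    reals (iter ''c'' select_step s k) ''t'' 0 = gain (nats (iter ''c'' select_step s k) ''z'' 0) \<and>
    (\<forall>c<k. gain c \<le> reals (iter ''c'' select_step s k) ''t'' 0)"
    using assms(4,5)
  proof (induction k)
    case (Suc k)
    let ?s = "iter ''c'' select_step s k"
    note defs = select_step_def score_step_def chain_step_def pred_step_def
    have sc: "scoring xs ?s" using assms(1) by (simp add: scoring_frame defs)
    have c: "nats ?s ''c'' 0 = k" by (simp add: frame defs)
    have "k < length xs" using Suc.prems by simp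
    note step = run_select_step[OF sc c this]
    show ?case
    proof (cases k)
      case 0
      \<comment> \<open>The first gain is at least the start value 0 and the test is non-strict, so
        candidate 0 is accepted and from then on \<open>t\<close> is the gain of candidate
        \<open>z\<close>.\<close>
      then show ?thesis using step assms(2,3) by simp
    next
      case (Suc k')
      then show ?thesis using step Suc.IH Suc.prems by (auto simp: less_Suc_eq max_def)
    qed
  qed simp
  then show "nats (iter ''c'' select_step s k) ''z'' 0 < k"
    "reals (iter ''c'' select_step s k) ''t'' 0 = gain (nats (iter ''c'' select_step s k) ''z'' 0)"
    "\<forall>c<k. gain c \<le> reals (iter ''c'' select_step s k) ''t'' 0" by blast+
qed

end

end

section \<open>The complete program\<close>

lemma nth_concat_uniform:
  assumes "\<And>x. x \<in> set xs \<Longrightarrow> length x = n" "j < length xs" "i < n"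
  shows "j * n + i < length (concat xs) \<and> concat xs ! (j * n + i) = xs ! j ! i"
  using assms(1,2)
proof (induction xs arbitrary: j)
  case (Cons x xs)
  have x: "length x = n" using Cons.prems(1) by simp
  show ?case
  proof (cases j)
    case 0
    then show ?thesis using x assms(3) by (simp add: nth_append)
  next
    case (Suc j')
    then have "j' * n + i < length (concat xs) \<and> concat xs ! (j' * n + i) = xs ! j' ! i"
      using Cons by simp
    then show ?thesis using x Suc by (simp add: nth_append add.assoc)
  qed
qed simp

lemma cost_total_dist:
  assumes "distinct ps"
  shows "cost w x (set ps) = total_dist w ps x / length ps"
proof -
  have "(\<Sum>p\<in>set ps. ulam_dist w x p) = (\<Sum>p\<leftarrow>ps. ulam_dist w x p)"
    using assms by (simp add: sum_list_distinct_conv_sum_set)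
  also have "\<dots> = total_dist w ps x"
    unfolding total_dist_def by (simp add: sum_list_sum_nth atLeast0LessThan)
  finally show ?thesis
    unfolding cost_def using assms by (simp add: distinct_card)
qed

lemmas program_defs = multiples_prog_def multiples_step_def pos_prog_def pos_row_def pos_step_def
  maj_prog_def maj_row_def maj_step_def count_step_def reduce_prog_def init_step_def reduce_rows_def
  reduce_row_def reduce_step_def lower_to_def charge_def rank_prog_def rank_step_def tally_step_def
  select_prog_def select_step_def score_step_def chain_step_def pred_step_def
  output_prog_def output_step_def

context median_instance
begin

lemma base_multiples_prog:
  "base (run multiples_prog (input_state n ps w))"
  "rows ps (nats (run multiples_prog (input_state n ps w)) ''P'')"
proof -
  let ?s = "input_state n ps w"
  have "nats (run multiples_prog ?s) ''M'' k = k * n" if "k \<le> n + length ps" for k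
    using iter_multiples_step[of ?s k "n + length ps"] that
    by (simp add: multiples_prog_def run_LFor input_state_def)
  then show "base (run multiples_prog ?s)"
    unfolding base_def by (simp add: frame program_defs) (simp add: input_state_def)
  have "nats ?s ''P'' (j * n + i) = ps ! j ! i" if "j < length ps" "i < n" for i j
    using nth_concat_uniform[of ps n j i] that ps(2) permsD by (auto simp: input_state_def)
  then show "rows ps (nats (run multiples_prog ?s) ''P'')"
    unfolding rows_def by (simp add: frame program_defs)
qed

lemma iter_output_step:
  assumes "base s" "nats s ''z'' 0 \<le> length ps" "k \<le> n" "i < k"
  shows "nats (iter ''i'' output_step s k) ''y'' i = nats s ''P'' (nats s ''z'' 0 * n + i)"
  using assms(3,4)
proof (induction k)
  case (Suc k)
  let ?s = "iter ''i'' output_step s k"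
  have "base ?s" using assms(1) by (simp add: frame output_step_def)
  moreover have "nats ?s ''i'' 0 = k" by (simp add: frame output_step_def)
  moreover have "nats ?s ''P'' = nats s ''P''" "nats ?s ''z'' = nats s ''z''"
    by (simp_all add: frame output_step_def)
  ultimately show ?case using Suc assms(2) by (auto simp: output_step_def)
qed simp

text \<open>One intermediate state per phase: each phase establishes its own property, and the frame
  rules carry the earlier ones along.\<close>

lemma run_median_prog:
  assumes x: "x \<in> perms n"
  defines "out \<equiv> output_list n (run median_prog (input_state n ps w))"
  shows "out \<in> perms n" and "25 * total_dist w ps out \<le> 49 * total_dist w ps x"
proof -
  define s1 where "s1 = run multiples_prog (input_state n ps w)"
  define s2 where "s2 = run pos_prog s1"
  define s3 where "s3 = run maj_prog s2"
  define s4 where "s4 = run reduce_prog s3"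
  define s5 where "s5 = run rank_prog s4"
  define s6 where "s6 = run select_prog s5"
  have s1: "base s1" "rows ps (nats s1 ''P'')"
    unfolding s1_def by (rule base_multiples_prog)+
  have s2: "base s2" "rows ps (nats s2 ''P'')" "positions (nats s2 ''pos'')"
    using s1 positions_pos_prog[OF s1] unfolding s2_def by (simp_all add: frame program_defs)
  have s3: "base s3" "rows ps (nats s3 ''P'')" "positions (nats s3 ''pos'')" "majorities (nats s3 ''E'')"
    using s2 majorities_maj_prog[OF s2(1,3)] unfolding s3_def by (simp_all add: frame program_defs)
  define r where "r = reals s4 ''r''"
  have r: "partial_cover ps n w r" "acyclic_support ps n r"
    using reduced_reduce_prog[OF s3(1,4)] unfolding r_def s4_def by simp_all
  have s4: "base s4" "rows ps (nats s4 ''P'')" "positions (nats s4 ''pos'')" "majorities (nats s4 ''E'')"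
    using s3 unfolding s4_def by (simp_all add: frame program_defs)
  have s5: "base s5" "positions (nats s5 ''pos'')"
    using s4 unfolding s5_def by (simp_all add: frame program_defs)
  define y where "y = map (\<lambda>i. nats s5 ''P'' (length ps * n + i)) [0..<n]"
  define xs where "xs = ps @ [y]"
  have run_rank: "s5 = iter ''a'' rank_step s4 n"
    using s4(1) unfolding s5_def by (simp add: rank_prog_def run_LFor)
  note rank = iter_rank_step[OF r(2) s4(1,4) r_def[symmetric] order_refl, folded run_rank]
  have "y ! order_rank r a = a" if "a \<in> {1..n}" for a
    using rank(1) that order_rank_less[OF r(2) that] unfolding y_def by simp
  then have y: "y \<in> perms n"
    "\<And>a b. a \<in> {1..n} \<Longrightarrow> b \<in> {1..n} \<Longrightarrow> 0 < r a \<Longrightarrow> 0 < r b \<Longrightarrow> maj ps a b \<Longrightarrow> bef y a b"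
    using ranked_list[OF r(2), of y] by (simp_all add: y_def)
  have xs: "set xs \<subseteq> perms n" "length xs = Suc (length ps)"
    using y(1) ps(2) unfolding xs_def by auto
  have "nats s5 ''P'' (c * n + i) = xs ! c ! i" if "c < length xs" "i < n" for c i
  proof (cases "c < length ps")
    case True
    \<comment> \<open>Addresses of input rows lie below \<open>length ps * n\<close>, the region
      that the ranking preserves.\<close>
    have "c * n + i < Suc c * n" using that by simp
    also have "\<dots> \<le> length ps * n" using True by (intro mult_le_mono1) simp
    finally show ?thesis using rank(2) rowsD[OF s4(2) True that(2)] True by (simp add: xs_def nth_append)
  next
    case False
    then show ?thesis using that by (simp add: xs_def nth_append y_def less_Suc_eq)
  qed
  then have s5_rows: "rows xs (nats s5 ''P'')" unfolding rows_def by blast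
  define s5' where "s5' = nset ''z'' 0 0 (rset ''t'' 0 0 s5)"
  have s5': "scoring xs s5'" "reals s5' ''t'' 0 = 0" "nats s5' ''z'' 0 = 0" "base s5'"
    using s5 s5_rows unfolding s5'_def by (simp_all add: scoring_def frame nats_nset_other)
  have run_select: "s6 = iter ''c'' select_step s5' (length xs)"
    using s5(1) xs(2) unfolding s6_def s5'_def select_prog_def by (simp add: run_LFor)
  define z where "z = nats s6 ''z'' 0"
  have "0 < length xs" using xs(2) by simp
  note select = iter_select_step[OF xs(1) eq_refl[OF xs(2)] s5'(1-3) order_refl this,
      folded run_select z_def]
  have s6: "base s6" "nats s6 ''P'' = nats s5 ''P''"
    using s5(1) unfolding s6_def by (simp_all add: frame nats_nset_other program_defs)
  have "out = map (nats (iter ''i'' output_step s6 n) ''y'') [0..<n]"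
    using s6(1)
    unfolding out_def output_list_def median_prog_def s6_def s5_def s4_def s3_def s2_def s1_def
    by (simp add: output_prog_def run_LFor)
  also have "\<dots> = map (\<lambda>i. xs ! z ! i) [0..<n]"
    using iter_output_step[OF s6(1) _ order_refl] s6(2) select(1) xs(2) rowsD[OF s5_rows]
    by (simp add: z_def)
  also have "\<dots> = xs ! z"
    using permsD[of "xs ! z" n] xs(1) nth_mem[OF select(1)] by (metis map_nth subsetD)
  finally have out: "out = xs ! z" .
  then show "out \<in> perms n" using xs(1) nth_mem[OF select(1)] by auto
  have gain: "gain xs c = length ps * sum w {1..n} - total_dist w ps (xs ! c)" for c
    unfolding gain_def[OF xs(1) eq_refl[OF xs(2)]] total_dist_def by (simp add: sum_subtractf)
  have "total_dist w ps out \<le> total_dist w ps (xs ! c)" if "c < length xs" for c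
    using select(2,3) that gain[of c] gain[of z] unfolding out by force
  then have "total_dist w ps out \<le> total_dist w ps v" if "v \<in> insert y (set ps)" for v
    using that unfolding xs_def by (metis Un_insert_right in_set_conv_nth list.set(1) list.simps(15) set_append sup_bot.right_neutral)
  moreover obtain v where "v \<in> insert y (set ps)" "25 * total_dist w ps v \<le> 49 * total_dist w ps x"
    using best_candidate[OF ps wpos x r(1) y] by blast
  ultimately show "25 * total_dist w ps out \<le> 49 * total_dist w ps x" by fastforce
qed

text \<open>The loop bounds are \<open>n\<close>, \<open>m\<close>, \<open>m + 1\<close> and
  \<open>n + m\<close>. Since \<open>1 \<le> n\<close> gives \<open>m \<le> m * n\<close>, all are
  at most \<open>input_size n ps + 1\<close>; composition with \<open>[:1, 1:]\<close> substitutes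
  this value into the time polynomial.\<close>

lemma steps_median_prog:
  assumes "1 \<le> n"
  shows "steps (poly (pcompose (time median_prog) [:1, 1:]) (input_size n ps)) (compile median_prog, input_state n ps w)
    = return_pmf (SKIP, run median_prog (input_state n ps w))"
proof -
  have "length ps \<le> length ps * n" using assms by simp
  then have size: "n + length ps + 1 \<le> input_size n ps + 1" unfolding input_size_def by simp
  have "\<exists>t \<le> poly (time median_prog) (input_size n ps + 1).
    exec (compile median_prog) (input_state n ps w) (run median_prog (input_state n ps w)) t"
  proof (rule exec_compile[where K = "{''n'', ''m''}"])
    show "fresh_counters median_prog" unfolding median_prog_def program_defs by simp
    show "nat_reads b \<subseteq> {''n'', ''m''}" if "b \<in> bounds median_prog" for b
      using that unfolding median_prog_def program_defs by auto
    show "{''n'', ''m''} \<inter> nat_writes median_prog = {}"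
      unfolding median_prog_def program_defs by simp
    show "nval b (input_state n ps w) \<le> input_size n ps + 1" if "b \<in> bounds median_prog" for b
      using that size unfolding median_prog_def program_defs by (auto simp: input_state_def)
  qed
  then show ?thesis using exec_steps by (auto simp: poly_pcompose add.commute)
qed

end

theorem theorem1p3:
  fixes c :: nat
  shows "\<exists>(A :: com) (T :: nat poly).
    \<forall>(n :: nat) (P :: nat list set) (ps :: nat list list) (w :: nat \<Rightarrow> real).
      n \<ge> 1 \<longrightarrow> P \<noteq> {} \<longrightarrow> P \<subseteq> perms n \<longrightarrow> distinct ps \<longrightarrow> set ps = P \<longrightarrow>
      (\<forall>e \<in> {1..n}. w e > 0) \<longrightarrow>
      (let t = poly T (input_size n ps) in
         halts_within t A (input_state n ps w) \<and>
         measure_pmf.prob (steps t (A, input_state n ps w))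
           {(_, s). output_list n s \<in> approx_medians 1.968 n w P} \<ge> 1 - 1 / real n ^ c)"
proof (intro exI allI impI)
  fix n :: nat and P :: "nat list set" and ps :: "nat list list" and w :: "nat \<Rightarrow> real"
  assume n: "1 \<le> n" and P: "P \<noteq> {}" "P \<subseteq> perms n" "set ps = P" and dist: "distinct ps"
    and w: "\<forall>e \<in> {1..n}. w e > 0"
  interpret median_instance n ps w
    by unfold_locales (use P w in auto)
  let ?t = "poly (pcompose (time median_prog) [:1, 1:]) (input_size n ps)"
  let ?s = "run median_prog (input_state n ps w)"
  note steps = steps_median_prog[OF n]
  have "OPT n w P \<in> (\<lambda>x. cost w x P) ` perms n"
    unfolding OPT_def using P by (intro Min_in) auto
  then obtain x where x: "x \<in> perms n" "OPT n w P = cost w x P" by blast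
  have le: "25 * total_dist w ps (output_list n ?s) \<le> 49 * total_dist w ps x"
    by (rule run_median_prog(2)[OF x(1)])
  \<comment> \<open>Nonnegativity of the optimum is what allows relaxing the factor 49/25 = 1.96 to
    1.968.\<close>
  have "ulam_dist w x (ps ! j) \<ge> 0" if j: "j < length ps" for j
  proof -
    obtain X where "X \<subseteq> {1..n}" "agree x (ps ! j) X" "ulam_dist w x (ps ! j) = sum w {1..n} - sum w X"
      by (rule ulam_dist_agree_obtains[OF x(1) nth_ps(1)[OF j] wpos])
    then show ?thesis using wpos sum_mono2[of "{1..n}" X w] by (auto simp: less_imp_le)
  qed
  then have "0 \<le> total_dist w ps x" unfolding total_dist_def by (intro sum_nonneg) auto
  then have le': "total_dist w ps (output_list n ?s) \<le> 1.968 * total_dist w ps x" using le by simp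
  have cost: "cost w v P = total_dist w ps v / length ps" for v
    using cost_total_dist[OF dist] P(3) by simp
  have "cost w (output_list n ?s) P \<le> 1.968 * OPT n w P"
    using divide_right_mono[OF le', of "real (length ps)"] unfolding x(2) cost by simp
  then have "output_list n ?s \<in> approx_medians 1.968 n w P"
    using run_median_prog(1)[OF x(1)] unfolding approx_medians_def by simp
  \<comment> \<open>The final distribution is a point mass on a good output, so the probability is 1
    and the bound holds for every exponent \<open>c\<close>.\<close>
  then show "let t = ?t in halts_within t (compile median_prog) (input_state n ps w) \<and>
      measure_pmf.prob (steps t (compile median_prog, input_state n ps w))
        {(_, s). output_list n s \<in> approx_medians 1.968 n w P} \<ge> 1 - 1 / real n ^ c"
    unfolding Let_def halts_within_def steps by (simp add: measure_return_pmf)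
qed

end
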